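(* Let $a\in C^3[0,1]$ and $b\in C^2[0,1]$ be real-valued functions, let $(\lambda_n)_{n\in\mathbb{Z}\setminus\{0\}}$ be the eigenvalues of the problem $$u_{xx}-(\lambda^{2}+2\lambda a(x)-b(x))u=0,\quad x\in(0,1),\qquad u(0)=u(1)=0,$$ enumerated as described in the context, and let $c_0=-\langle a\rangle$. Then $$\sum_{\substack{n=-\infty\\ n\neq 0}}^{\infty}(\lambda_n-c_0)=\frac{a(0)+a(1)}{2}-\langle a\rangle ,$$ where the two-sided series is understood as $\lim_{N\to\infty}\sum_{1\le |n|\le N}(\lambda_n-c_0)$.
   Context: For a function $f$ on $[0,1]$, $\langle f\rangle:=\int_0^1 f(x)\,dx$. A number $\lambda\in\mathbb{C}$ is an eigenvalue of the problem $u_{xx}-(\lambda^{2}+2\lambda a-b)u=0$ on $(0,1)$, $u(0)=u(1)=0$, if the problem has a nontrivial solution $u$. Equivalently, $\lambda$ is a zero of the entire function $\gamma_0(\lambda):=u(1,\lambda)$, where $u(x,\lambda)$ solves the differential equation with $u(0,\lambda)=0$, $u_x(0,\lambda)=1$. Eigenvalues are repeated according to their multiplicity as zeros of $\gamma_0$. Since $a,b$ are real, $\overline{\lambda}$ is an eigenvalue whenever $\lambda$ is. The eigenvalues are enumerated as $\lambda_n$, $n\in\mathbb{Z}\setminus\{0\}$, with $$\ldots\le \mathrm{Im}\,\lambda_{-2}\le \mathrm{Im}\,\lambda_{-1}\le \mathrm{Im}\,\lambda_1\le \mathrm{Im}\,\lambda_2\le\ldots$$ and $\lambda_{-n}=\overline{\lambda_n}$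 whenever $\lambda_n$ is not real. The number $c_0=-\langle a\rangle$ is the constant term in the asymptotics $\lambda_n=\pi n\,\mathrm{i}+c_0+\mathcal{O}(n^{-1})$, $n\to\pm\infty$. *)

theory Defs
  imports "HOL-Complex_Analysis.Complex_Analysis"
begin

(* C^k[0,1] with one-sided derivatives at the endpoints; D i is the i-th derivative.
   The library's C1_differentiable_on uses two-sided derivatives, so it does not apply on a
   closed interval. *)
definition Ck_unit_interval :: "nat \<Rightarrow> (real \<Rightarrow> real) \<Rightarrow> bool" where
  "Ck_unit_interval k f \<longleftrightarrow>
     (\<exists>D :: nat \<Rightarrow> real \<Rightarrow> real.
        D 0 = f \<and>
        (\<forall>i<k. \<forall>x\<in>{0..1}. (D i has_real_derivative D (Suc i) x) (at x within {0..1})) \<and>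
        continuous_on {0..1} (D k))"

(* u is a solution of u_xx - (z^2 + 2 z a - b) u = 0 on (0,1) that is C^1 up to the boundary,
   and u' is its derivative u_x. *)
definition damped_solution ::
  "(real \<Rightarrow> real) \<Rightarrow> (real \<Rightarrow> real) \<Rightarrow> complex \<Rightarrow> (real \<Rightarrow> complex) \<Rightarrow> (real \<Rightarrow> complex) \<Rightarrow> bool" where
  "damped_solution a b z u u' \<longleftrightarrow>
     (\<forall>x\<in>{0..1}. (u has_vector_derivative u' x) (at x within {0..1})) \<and>
     continuous_on {0..1} u' \<and>
     (\<forall>x\<in>{0<..<1}. \<exists>u''. (u' has_vector_derivative u'') (at x) \<and>
        u'' - (z\<^sup>2 + 2 * z * of_real (a x) - of_real (b x)) * u x = 0)"

definition dirichlet_eigenvalue :: "(real \<Rightarrow> real) \<Rightarrow> (real \<Rightarrow> real) \<Rightarrow> complex \<Rightarrow> bool" where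
  "dirichlet_eigenvalue a b z \<longleftrightarrow>
     (\<exists>u u'. damped_solution a b z u u' \<and> u 0 = 0 \<and> u 1 = 0 \<and> (\<exists>x\<in>{0..1}. u x \<noteq> 0))"

(* The value u(1,z) of the solution with u(0,z) = 0, u_x(0,z) = 1; that solution exists and is
   unique on [0,1] for continuous a and b. *)
definition gamma0 :: "(real \<Rightarrow> real) \<Rightarrow> (real \<Rightarrow> real) \<Rightarrow> complex \<Rightarrow> complex" where
  "gamma0 a b z =
     (THE w. \<exists>u u'. damped_solution a b z u u' \<and> u 0 = 0 \<and> u' 0 = 1 \<and> w = u 1)"

(* l enumerates the eigenvalues over the nonzero integers, each one as often as its multiplicity
   as a zero of gamma0; the value l 0 is irrelevant. *)
definition eigenvalue_enumeration ::
  "(real \<Rightarrow> real) \<Rightarrow> (real \<Rightarrow> real) \<Rightarrow> (int \<Rightarrow> complex) \<Rightarrow> bool" where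
  "eigenvalue_enumeration a b l \<longleftrightarrow>
     (\<forall>n. n \<noteq> 0 \<longrightarrow> dirichlet_eigenvalue a b (l n)) \<and>
     (\<forall>z. dirichlet_eigenvalue a b z \<longrightarrow>
        finite {n. n \<noteq> 0 \<and> l n = z} \<and>
        int (card {n. n \<noteq> 0 \<and> l n = z}) = zorder (gamma0 a b) z) \<and>
     (\<forall>m n. m \<noteq> 0 \<longrightarrow> n \<noteq> 0 \<longrightarrow> m \<le> n \<longrightarrow> Im (l m) \<le> Im (l n)) \<and>
     (\<forall>n. n \<noteq> 0 \<longrightarrow> l n \<notin> \<real> \<longrightarrow> l (- n) = cnj (l n))"

end

(* Put A(x) = int_0^x a and c0 = -A(1). A second-order WKB expansion gives, for w = z - c0 and
   s = (a(0) + a(1)) / 2,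
     z gamma0(z) / sinh w = 1 - s / w - K coth w / w + O(1 / w^2)
   with a constant K, uniformly away from the zeros of sinh. The argument principle on the circles
   |w| = pi (N + 1/2) compares gamma0(z) with sinh(w) / z. Its weight 1 shows that exactly 2N
   eigenvalues lie inside, and these are the ones with 1 <= |n| <= N. Its weight w, after an
   integration by parts, expresses the sum of (lambda_n - c0) through the integral of
   Ln (z gamma0(z) / sinh w): the term s / w contributes s, the factor 1 / z contributes c0, and
   coth w / w is even, so it contributes nothing. *)
theory Submission
  imports Defs
begin

section \<open>Linear second-order equations depending polynomially on a parameter\<close>

text \<open>\<open>gamma0\<close> is given by a definite description and multiplicities by
  \<open>zorder\<close>, so existence, uniqueness and holomorphy in z have to come first; Picard
  iteration yields existence and holomorphy together. The second order of the expansion is forced by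
  the weight w: an error O(1 / w^2) on a circle of length 2 pi R leaves O(1 / R), while the explicit
  term of order 1 / w supplies s. To reach this order, the equation becomes a Volterra equation
  whose integrands carry no factor z; it is inserted into itself once, and the oscillating integrals
  that remain gain another power of 1 / z from one integration by parts. All estimates carry the
  weight exp |Re z|, which is also the growth of sinh away from its zeros, so they are uniform on
  whole circles. No asymptotics of single eigenvalues enter. The last obstacle is that circles
  select zeros by |w| while the enumeration orders them by Im: zeros close to the chosen circles are
  excluded, so both orders cut off the same zeros there, and the count 2N then fixes the
  indices.\<close>

text \<open>Polynomials in the parameter with coefficients continuous on the unit interval; values outside the interval are irrelevant.\<close>

inductive polyfam :: "(complex \<Rightarrow> real \<Rightarrow> complex) \<Rightarrow> bool" where
  polyfam_continuous: "continuous_on {0..1} c \<Longrightarrow> polyfam (\<lambda>z. c)"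
| polyfam_add: "polyfam f \<Longrightarrow> polyfam g \<Longrightarrow> polyfam (\<lambda>z x. f z x + g z x)"
| polyfam_times_param: "polyfam f \<Longrightarrow> polyfam (\<lambda>z x. z * f z x)"
| polyfam_cong: "polyfam f \<Longrightarrow> (\<And>z x. x \<in> {0..1} \<Longrightarrow> g z x = f z x) \<Longrightarrow> polyfam g"

lemma polyfam_imp_continuous:
  assumes "polyfam f"
  shows "continuous_on {0..1} (f z)"
  using assms
proof induction
  case (polyfam_cong f g)
  then show ?case by (metis continuous_on_cong)
qed (auto intro!: continuous_intros)

lemma polyfam_imp_holomorphic:
  assumes "polyfam f" "x \<in> {0..1}"
  shows "(\<lambda>z. f z x) holomorphic_on UNIV"
  using assms
proof induction
  case (polyfam_cong f g)
  then show ?case by simp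
qed (auto intro!: holomorphic_intros)

lemma polyfam_bounded:
  assumes "polyfam f"
  obtains M where "M \<ge> 1" "\<And>z x. norm z \<le> r \<Longrightarrow> x \<in> {0..1} \<Longrightarrow> norm (f z x) \<le> M"
proof -
  have "\<exists>M\<ge>1. \<forall>z x. norm z \<le> r \<longrightarrow> x \<in> {0..1} \<longrightarrow> norm (f z x) \<le> M"
    using assms
  proof induction
    case (polyfam_continuous c)
    then have "bounded (c ` {0..1})"
      by (intro compact_imp_bounded compact_continuous_image) auto
    then obtain B where "\<forall>x\<in>{0..1}. norm (c x) \<le> B"
      by (auto simp: bounded_iff)
    then show ?case
      by (intro exI[of _ "max 1 B"]) (auto simp: le_max_iff_disj)
  next
    case (polyfam_add f g)
    then obtain M1 M2 where "M1 \<ge> 1" "\<forall>z x. norm z \<le> r \<longrightarrow> x \<in> {0..1} \<longrightarrow> norm (f z x) \<le> M1"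
      "M2 \<ge> 1" "\<forall>z x. norm z \<le> r \<longrightarrow> x \<in> {0..1} \<longrightarrow> norm (g z x) \<le> M2"
      by blast
    then show ?case
      by (intro exI[of _ "M1 + M2"]) (auto intro!: order.trans[OF norm_triangle_ineq] add_mono)
  next
    case (polyfam_times_param f)
    then obtain M where M: "M \<ge> 1" "\<And>z x. norm z \<le> r \<Longrightarrow> x \<in> {0..1} \<Longrightarrow> norm (f z x) \<le> M"
      by blast
    have "norm (z * f z x) \<le> max 1 r * M" if "norm z \<le> r" "x \<in> {0..1}" for z x
      unfolding norm_mult using that M by (intro mult_mono) auto
    then show ?case
      using M(1) mult_mono[of 1 "max 1 r" 1 M] by (intro exI[of _ "max 1 r * M"]) auto
  next
    case (polyfam_cong f g)
    then show ?case by simp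
  qed
  then show ?thesis using that by blast
qed

lemma polyfam_mult_continuous:
  assumes "polyfam f" "continuous_on {0..1} c"
  shows "polyfam (\<lambda>z x. c x * f z x)"
  using assms(1)
proof induction
  case (polyfam_continuous d)
  then show ?case
    by (intro polyfam.polyfam_continuous continuous_intros assms)
next
  case (polyfam_add f g)
  from polyfam.polyfam_add[OF polyfam_add.IH] show ?case
    by (rule polyfam.polyfam_cong) (simp add: algebra_simps)
next
  case (polyfam_times_param f)
  from polyfam.polyfam_times_param[OF polyfam_times_param.IH] show ?case
    by (rule polyfam.polyfam_cong) (simp add: algebra_simps)
next
  case (polyfam_cong f g)
  then show ?case by (auto intro: polyfam.polyfam_cong)
qed

lemma polyfam_mult:
  assumes "polyfam f" "polyfam g"
  shows "polyfam (\<lambda>z x. f z x * g z x)"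
  using assms(1)
proof induction
  case (polyfam_continuous d)
  with assms(2) show ?case
    by (rule polyfam_mult_continuous)
next
  case (polyfam_add f g)
  from polyfam.polyfam_add[OF polyfam_add.IH] show ?case
    by (rule polyfam.polyfam_cong) (simp add: algebra_simps)
next
  case (polyfam_times_param f)
  from polyfam.polyfam_times_param[OF polyfam_times_param.IH] show ?case
    by (rule polyfam.polyfam_cong) (simp add: algebra_simps)
next
  case (polyfam_cong f g)
  then show ?case by (auto intro: polyfam.polyfam_cong)
qed

lemma integrable_on_initial_interval:
  fixes f :: "real \<Rightarrow> 'a::banach"
  assumes "continuous_on {0..1} f" "x \<in> {0..1}"
  shows "f integrable_on {0..x}"
  by (rule integrable_continuous_real, rule continuous_on_subset[OF assms(1)]) (use assms(2) in auto)

text \<open>Integration in x only changes the coefficients, so holomorphy in z survives it without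
  any differentiation under the integral sign. This is the purpose of the class.\<close>

lemma polyfam_integral:
  assumes "polyfam f"
  shows "polyfam (\<lambda>z x. integral {0..x} (f z))"
  using assms
proof induction
  case (polyfam_continuous c)
  show ?case
    by (rule polyfam.polyfam_continuous, rule indefinite_integral_continuous_1,
        rule integrable_continuous_real, fact)
next
  case (polyfam_add f g)
  from polyfam.polyfam_add[OF polyfam_add.IH] show ?case
    by (rule polyfam.polyfam_cong)
       (intro Henstock_Kurzweil_Integration.integral_add integrable_on_initial_interval
          polyfam_imp_continuous polyfam_add.hyps)
next
  case (polyfam_times_param f)
  from polyfam.polyfam_times_param[OF polyfam_times_param.IH] show ?case
    by (rule polyfam.polyfam_cong) simp
next
  case (polyfam_cong f g)
  from polyfam_cong.IH show ?case
    by (rule polyfam.polyfam_cong)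
       (intro Henstock_Kurzweil_Integration.integral_cong polyfam_cong.hyps, auto)
qed

text \<open>Terms of the series solution of u(x) = x + int_0^x int_0^s Q u, the integrated form of
  u'' = Q u with u(0) = 0 and u'(0) = 1.\<close>

primrec picard_term :: "(complex \<Rightarrow> real \<Rightarrow> complex) \<Rightarrow> nat \<Rightarrow> complex \<Rightarrow> real \<Rightarrow> complex" where
  "picard_term Q 0 = (\<lambda>z x. of_real x)"
| "picard_term Q (Suc k) =
     (\<lambda>z x. integral {0..x} (\<lambda>s. integral {0..s} (\<lambda>t. Q z t * picard_term Q k z t)))"

lemma polyfam_picard_term:
  assumes "polyfam Q"
  shows "polyfam (picard_term Q k)"
proof (induction k)
  case 0
  show ?case by (auto intro!: polyfam_continuous continuous_intros)
next
  case (Suc k)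
  show ?case
    using polyfam_integral[OF polyfam_integral[OF polyfam_mult[OF assms Suc]]] by simp
qed

section \<open>Convergence of the Picard series\<close>

lemma norm_integral_le_const:
  fixes f :: "real \<Rightarrow> complex"
  assumes "continuous_on {0..1} f" "x \<in> {0..1}" "\<And>t. t \<in> {0..x} \<Longrightarrow> norm (f t) \<le> B"
  shows "norm (integral {0..x} f) \<le> B"
proof -
  have "0 \<le> norm (f 0)" by simp
  also have "\<dots> \<le> B" using assms(2,3) by simp
  finally have "B \<ge> 0" .
  have "norm (integral {0..x} f) \<le> integral {0..x} (\<lambda>_. B)"
    by (rule integral_norm_bound_integral[OF integrable_on_initial_interval[OF assms(1,2)]])
       (use assms(3) in auto)
  also have "\<dots> \<le> B" using assms(2) \<open>B \<ge> 0\<close> by (auto intro: mult_left_le_one_le mult_right_le_one_le)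
  finally show ?thesis .
qed

text \<open>The inner integration turns t^k / k! into s^(k+1) / (k+1)!. The outer one runs over a
  length of at most 1 and is merely estimated by the maximum of its integrand.\<close>

lemma picard_term_bound:
  assumes Q: "polyfam Q" and M: "\<And>t. t \<in> {0..1} \<Longrightarrow> norm (Q z t) \<le> M"
    and "x \<in> {0..1}"
  shows "norm (picard_term Q k z x) \<le> M ^ k * x ^ k / fact k"
  using \<open>x \<in> {0..1}\<close>
proof (induction k arbitrary: x)
  case 0
  then show ?case by simp
next
  case (Suc k)
  have "0 \<le> norm (Q z 0)" by simp
  also have "\<dots> \<le> M" using M by simp
  finally have "M \<ge> 0" .
  note qp = polyfam_mult[OF Q polyfam_picard_term[OF Q, of k]]
  have inner: "norm (integral {0..s} (\<lambda>t. Q z t * picard_term Q k z t)) \<le> M ^ Suc k * s ^ Suc k / fact (Suc k)"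
    if s: "s \<in> {0..1}" for s
  proof -
    have "norm (integral {0..s} (\<lambda>t. Q z t * picard_term Q k z t)) \<le> integral {0..s} (\<lambda>t. M ^ Suc k / fact k * t ^ k)"
    proof (rule integral_norm_bound_integral)
      show "(\<lambda>t. Q z t * picard_term Q k z t) integrable_on {0..s}"
        using integrable_on_initial_interval[OF polyfam_imp_continuous[OF qp, of z] s] .
      show "(\<lambda>t. M ^ Suc k / fact k * t ^ k) integrable_on {0..s}"
        by (intro integrable_continuous_real continuous_intros)
      fix t assume "t \<in> {0..s}"
      then have "t \<in> {0..1}" using s by auto
      then have "norm (Q z t * picard_term Q k z t) \<le> M * (M ^ k * t ^ k / fact k)"
        unfolding norm_mult using \<open>M \<ge> 0\<close> by (intro mult_mono M Suc.IH) auto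
      then show "norm (Q z t * picard_term Q k z t) \<le> M ^ Suc k / fact k * t ^ k" by simp
    qed
    also have "\<dots> = M ^ Suc k / fact k * integral {0..s} (\<lambda>t. t ^ k)" by simp
    also have "integral {0..s} (\<lambda>t. t ^ k) = s ^ Suc k / Suc k"
    proof (rule integral_unique)
      have der: "((\<lambda>t. t ^ Suc k / real (Suc k)) has_real_derivative t ^ k) (at t)" for t
        by (rule DERIV_cong[OF DERIV_cdivide[OF DERIV_pow]]) simp
      have "((\<lambda>t. t ^ k) has_integral (s ^ Suc k / Suc k - 0 ^ Suc k / Suc k)) {0..s}"
        using s by (intro fundamental_theorem_of_calculus)
          (auto simp flip: has_real_derivative_iff_has_vector_derivative
             simp del: power_Suc of_nat_Suc intro: DERIV_subset[OF der])
      then show "((\<lambda>t. t ^ k) has_integral (s ^ Suc k / Suc k)) {0..s}" by simp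
    qed
    finally show ?thesis by (simp add: field_simps)
  qed
  have "norm (picard_term Q (Suc k) z x) \<le> M ^ Suc k * x ^ Suc k / fact (Suc k)"
    unfolding picard_term.simps
  proof (rule norm_integral_le_const)
    show "continuous_on {0..1} (\<lambda>s. integral {0..s} (\<lambda>t. Q z t * picard_term Q k z t))"
      using polyfam_imp_continuous[OF polyfam_integral[OF qp]] .
    fix t assume t: "t \<in> {0..x}"
    have "norm (integral {0..t} (\<lambda>t. Q z t * picard_term Q k z t)) \<le> M ^ Suc k * t ^ Suc k / fact (Suc k)"
      using t Suc.prems by (intro inner) auto
    also have "\<dots> \<le> M ^ Suc k * x ^ Suc k / fact (Suc k)"
      using t \<open>M \<ge> 0\<close> by (intro divide_right_mono mult_left_mono power_mono) auto
    finally show "norm (integral {0..t} (\<lambda>t. Q z t * picard_term Q k z t)) \<le> M ^ Suc k * x ^ Suc k / fact (Suc k)" .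
  qed (use Suc.prems in auto)
  then show ?case .
qed

text \<open>The series converges uniformly for z in a disc and x in the unit interval at once. In x
  this gives continuity and lets the limit pass into the integral equation; in z it exhibits U(z, 1)
  as a locally uniform limit of polynomials.\<close>

lemma picard_solution:
  assumes Q: "polyfam Q"
  obtains U V where
    "\<And>z. U z 0 = 0" "\<And>z. V z 0 = (1::complex)"
    "\<And>z x. x \<in> {0..1} \<Longrightarrow> (U z has_vector_derivative V z x) (at x within {0..1})"
    "\<And>z x. x \<in> {0..1} \<Longrightarrow> (V z has_vector_derivative Q z x * U z x) (at x within {0..1})"
    "(\<lambda>z. U z 1) holomorphic_on UNIV"
proof -
  define U where "U = (\<lambda>z x. \<Sum>k. picard_term Q k z x)"
  define S where "S = (\<lambda>n z x. \<Sum>k<n. picard_term Q k z x)"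
  define V where "V = (\<lambda>z x. 1 + integral {0..x} (\<lambda>t. Q z t * U z t))"
  have S_step: "S (Suc n) z x = S n z x + picard_term Q n z x" for n z x
    by (simp add: S_def)
  have unif: "uniform_limit (cball 0 r \<times> {0..1}) (\<lambda>n (z, x). S n z x) (\<lambda>(z, x). U z x) sequentially" for r
  proof -
    obtain M where M: "M \<ge> 1" "\<And>z x. norm z \<le> r \<Longrightarrow> x \<in> {0..1} \<Longrightarrow> norm (Q z x) \<le> M"
      using polyfam_bounded[OF Q] by blast
    have "uniform_limit (cball 0 r \<times> {0..1}) (\<lambda>n p. \<Sum>k<n. (\<lambda>(z, x). picard_term Q k z x) p)
            (\<lambda>p. suminf (\<lambda>k. (\<lambda>(z, x). picard_term Q k z x) p)) sequentially"
    proof (rule Weierstrass_m_test)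
      show "summable (\<lambda>k. M ^ k / fact k)"
        using summable_exp[of M] by (simp add: field_simps)
      fix k and p :: "complex \<times> real" assume p: "p \<in> cball 0 r \<times> {0..1}"
      obtain z x where [simp]: "p = (z, x)" by (cases p)
      have "norm (picard_term Q k z x) \<le> M ^ k * x ^ k / fact k"
        using p M by (intro picard_term_bound[OF Q]) auto
      also have "\<dots> \<le> M ^ k * 1 / fact k"
        using p M(1) by (intro divide_right_mono mult_left_mono power_le_one) auto
      finally show "norm ((\<lambda>(z, x). picard_term Q k z x) p) \<le> M ^ k / fact k" by simp
    qed
    then show ?thesis unfolding U_def S_def case_prod_beta .
  qed
  have unif_x: "uniform_limit {0..1} (\<lambda>n x. S n z x) (U z) sequentially" for z
    using uniform_limit_compose'[OF unif[of "norm z"], of "\<lambda>x. (z, x)" "{0..1}"] by auto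
  have cont_S: "continuous_on {0..1} (S n z)" for n z
    unfolding S_def by (intro continuous_intros polyfam_imp_continuous polyfam_picard_term Q)
  have cont_U: "continuous_on {0..1} (U z)" for z
    by (rule uniform_limit_theorem[OF _ unif_x]) (auto simp: cont_S)
  have cont_QU: "continuous_on {0..1} (\<lambda>t. Q z t * U z t)" for z
    by (intro continuous_intros polyfam_imp_continuous Q cont_U)
  have int_cont: "continuous_on {0..1} (\<lambda>s. integral {0..s} f)" if "continuous_on {0..1} f" for f :: "real \<Rightarrow> complex"
    by (rule indefinite_integral_continuous_1) (intro integrable_continuous_real that)
  have cont_V: "continuous_on {0..1} (V z)" for z
    unfolding V_def by (intro continuous_intros int_cont cont_QU)
  \<comment> \<open>The partial sums are the Picard iterates, so the integral equation for
    \<open>U\<close> arises as the limit of this recursion.\<close>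
  have S_Suc: "S (Suc n) z x = of_real x + integral {0..x} (\<lambda>s. integral {0..s} (\<lambda>t. Q z t * S n z t))"
    if x: "x \<in> {0..1}" for n z x
  proof (induction n)
    case 0
    then show ?case by (simp add: S_def)
  next
    case (Suc n)
    have cont_p: "continuous_on {0..1} (\<lambda>t. Q z t * picard_term Q n z t)"
      by (intro continuous_intros polyfam_imp_continuous Q polyfam_picard_term)
    have cont_s: "continuous_on {0..1} (\<lambda>t. Q z t * S n z t)" for n
      by (intro continuous_intros polyfam_imp_continuous Q cont_S)
    have "integral {0..x} (\<lambda>s. integral {0..s} (\<lambda>t. Q z t * S (Suc n) z t)) =
          integral {0..x} (\<lambda>s. integral {0..s} (\<lambda>t. Q z t * S n z t) + integral {0..s} (\<lambda>t. Q z t * picard_term Q n z t))"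
    proof (rule Henstock_Kurzweil_Integration.integral_cong)
      fix s assume "s \<in> {0..x}"
      then have s: "s \<in> {0..1}" using x by auto
      show "integral {0..s} (\<lambda>t. Q z t * S (Suc n) z t) = integral {0..s} (\<lambda>t. Q z t * S n z t) + integral {0..s} (\<lambda>t. Q z t * picard_term Q n z t)"
        by (subst Henstock_Kurzweil_Integration.integral_add[symmetric])
           (auto intro!: integrable_on_initial_interval cont_p cont_s s simp: S_step algebra_simps)
    qed
    also have "\<dots> = integral {0..x} (\<lambda>s. integral {0..s} (\<lambda>t. Q z t * S n z t)) + picard_term Q (Suc n) z x"
      unfolding picard_term.simps
      by (rule Henstock_Kurzweil_Integration.integral_add)
         (intro integrable_on_initial_interval int_cont cont_p cont_s x)+
    finally show ?case using Suc by (simp add: S_def del: picard_term.simps)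
  qed
  have U_eq: "U z x = integral {0..x} (V z)" if x: "x \<in> {0..1}" for z x
  proof -
    define L where "L = of_real x + integral {0..x} (\<lambda>s. integral {0..s} (\<lambda>t. Q z t * U z t))"
    obtain M where M: "M \<ge> 1" "\<And>x. x \<in> {0..1} \<Longrightarrow> norm (Q z x) \<le> M"
      using polyfam_bounded[OF Q, of "norm z"] by (metis order_refl)
    have "(\<lambda>n. S (Suc n) z x) \<longlonglongrightarrow> L"
    proof (rule LIMSEQ_I)
      fix e :: real assume "e > 0"
      \<comment> \<open>The division by M compensates the factor Q, both integrations run over
        lengths of at most 1, and the half leaves room for a strict inequality.\<close>
      then have "\<forall>\<^sub>F n in sequentially. \<forall>t\<in>{0..1}. dist (S n z t) (U z t) < e / 2 / M"
        using M(1) by (intro uniform_limitD[OF unif_x]) auto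
      then obtain N where N: "\<And>n t. n \<ge> N \<Longrightarrow> t \<in> {0..1} \<Longrightarrow> norm (S n z t - U z t) < e / 2 / M"
        unfolding eventually_sequentially dist_norm by blast
      have "norm (S (Suc n) z x - L) < e" if "n \<ge> N" for n
      proof -
        have cont_s: "continuous_on {0..1} (\<lambda>t. Q z t * S n z t)" for n
          by (intro continuous_intros polyfam_imp_continuous Q cont_S)
        have "S (Suc n) z x - L = integral {0..x} (\<lambda>s. integral {0..s} (\<lambda>t. Q z t * S n z t) - integral {0..s} (\<lambda>t. Q z t * U z t))"
          unfolding S_Suc[OF x] L_def
          by (subst Henstock_Kurzweil_Integration.integral_diff)
             (auto intro!: integrable_on_initial_interval int_cont cont_QU cont_s x)
        also have "norm \<dots> \<le> e / 2"
        proof (rule norm_integral_le_const[OF _ x])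
          show "continuous_on {0..1} (\<lambda>s. integral {0..s} (\<lambda>t. Q z t * S n z t) - integral {0..s} (\<lambda>t. Q z t * U z t))"
            by (intro continuous_intros int_cont cont_s cont_QU)
          fix s assume "s \<in> {0..x}"
          then have s: "s \<in> {0..1}" using x by auto
          have "integral {0..s} (\<lambda>t. Q z t * S n z t) - integral {0..s} (\<lambda>t. Q z t * U z t)
             = integral {0..s} (\<lambda>t. Q z t * S n z t - Q z t * U z t)"
            by (subst Henstock_Kurzweil_Integration.integral_diff)
               (auto intro!: integrable_on_initial_interval cont_QU cont_s s)
          also have "norm \<dots> \<le> e / 2"
          proof (rule norm_integral_le_const[OF _ s])
            show "continuous_on {0..1} (\<lambda>t. Q z t * S n z t - Q z t * U z t)"
              by (intro continuous_intros cont_QU cont_s)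
            fix t assume "t \<in> {0..s}"
            then have t: "t \<in> {0..1}" using s by auto
            have "norm (Q z t * S n z t - Q z t * U z t) = norm (Q z t) * norm (S n z t - U z t)"
              by (simp add: norm_mult flip: right_diff_distrib)
            also have "\<dots> \<le> M * (e / 2 / M)"
              using M t N[OF \<open>n \<ge> N\<close> t] by (intro mult_mono) auto
            finally show "norm (Q z t * S n z t - Q z t * U z t) \<le> e / 2" using M(1) by simp
          qed
          finally show "norm (integral {0..s} (\<lambda>t. Q z t * S n z t) - integral {0..s} (\<lambda>t. Q z t * U z t)) \<le> e / 2" .
        qed
        finally show ?thesis using \<open>e > 0\<close> by simp
      qed
      then show "\<exists>no. \<forall>n\<ge>no. norm (S (Suc n) z x - L) < e" by blast
    qed
    moreover have "(\<lambda>n. S (Suc n) z x) \<longlonglongrightarrow> U z x"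
      using LIMSEQ_Suc[OF tendsto_uniform_limitI[OF unif_x x]] .
    ultimately have "U z x = L" using LIMSEQ_unique by blast
    also have "L = integral {0..x} (V z)"
      unfolding V_def L_def using x
      by (subst Henstock_Kurzweil_Integration.integral_add)
         (auto intro!: integrable_on_initial_interval int_cont cont_QU simp: scaleR_conv_of_real)
    finally show ?thesis .
  qed
  show ?thesis
  proof
    show "U z 0 = 0" "V z 0 = 1" for z by (simp_all add: U_eq V_def)
    show "(V z has_vector_derivative Q z x * U z x) (at x within {0..1})" if "x \<in> {0..1}" for z x
      unfolding V_def using that
      by (auto intro!: derivative_eq_intros integral_has_vector_derivative[OF cont_QU])
    show "(U z has_vector_derivative V z x) (at x within {0..1})" if "x \<in> {0..1}" for z x
      using integral_has_vector_derivative[OF cont_V that]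
      by (rule has_vector_derivative_transform[OF that, rotated]) (simp add: U_eq)
    show "(\<lambda>z. U z 1) holomorphic_on UNIV"
    proof (rule holomorphic_uniform_sequence)
      show "(\<lambda>z. S n z 1) holomorphic_on UNIV" for n
        unfolding S_def
        by (intro holomorphic_intros polyfam_imp_holomorphic polyfam_picard_term Q) auto
      fix z :: complex
      have "uniform_limit (cball z 1) (\<lambda>n z. S n z 1) (\<lambda>z. U z 1) sequentially"
      proof -
        have "norm w \<le> norm z + 1" if "w \<in> cball z 1" for w
          using that norm_triangle_ineq2[of w z] by (simp add: dist_norm norm_minus_commute)
        then have "(\<lambda>w. (w, 1::real)) \<in> cball z 1 \<rightarrow> cball 0 (norm z + 1) \<times> {0..1}" by auto
        from uniform_limit_compose'[OF unif this] show ?thesis by simp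
      qed
      then show "\<exists>d>0. cball z d \<subseteq> UNIV \<and> uniform_limit (cball z d) (\<lambda>n z. S n z 1) (\<lambda>z. U z 1) sequentially"
        by (auto intro!: exI[of _ 1])
    qed auto
  qed
qed

section \<open>The characteristic function\<close>

text \<open>Feeds the uniqueness lemma in two ways: c = 1 compares two normalised solutions, c =
  u'(0) compares an eigenfunction with the normalised solution.\<close>

lemma damped_solution_diff_cmult:
  assumes "damped_solution a b z u u'" "damped_solution a b z v v'"
  shows "damped_solution a b z (\<lambda>x. u x - c * v x) (\<lambda>x. u' x - c * v' x)"
  unfolding damped_solution_def
proof (intro conjI ballI)
  show "((\<lambda>x. u x - c * v x) has_vector_derivative u' x - c * v' x) (at x within {0..1})" if "x \<in> {0..1}" for x
    using assms that unfolding damped_solution_def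
    by (auto intro!: has_vector_derivative_diff has_vector_derivative_mult_right)
  show "continuous_on {0..1} (\<lambda>x. u' x - c * v' x)"
    using assms unfolding damped_solution_def by (auto intro!: continuous_intros)
  fix x :: real assume "x \<in> {0<..<1}"
  then obtain p q where pq: "(u' has_vector_derivative p) (at x)"
      "p - (z\<^sup>2 + 2 * z * of_real (a x) - of_real (b x)) * u x = 0"
      "(v' has_vector_derivative q) (at x)"
      "q - (z\<^sup>2 + 2 * z * of_real (a x) - of_real (b x)) * v x = 0"
    using assms unfolding damped_solution_def by metis
  show "\<exists>u''. ((\<lambda>x. u' x - c * v' x) has_vector_derivative u'') (at x) \<and>
          u'' - (z\<^sup>2 + 2 * z * of_real (a x) - of_real (b x)) * (u x - c * v x) = 0"
  proof (intro exI conjI)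
    show "((\<lambda>x. u' x - c * v' x) has_vector_derivative (p - c * q)) (at x)"
      by (intro has_vector_derivative_diff has_vector_derivative_mult_right pq)
    have "p = (z\<^sup>2 + 2 * z * of_real (a x) - of_real (b x)) * u x" "q = (z\<^sup>2 + 2 * z * of_real (a x) - of_real (b x)) * v x"
      using pq(2,4) by (simp_all only: right_minus_eq)
    then show "p - c * q - (z\<^sup>2 + 2 * z * of_real (a x) - of_real (b x)) * (u x - c * v x) = 0"
      by (simp only:) (simp add: algebra_simps)
  qed
qed

lemma damped_solutionD:
  assumes "damped_solution a b z u u'"
  shows "continuous_on {0..1} u" "continuous_on {0..1} u'"
    and "x \<in> {0<..<1} \<Longrightarrow> (u has_vector_derivative u' x) (at x)"
    and "x \<in> {0<..<1} \<Longrightarrow>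
           (u' has_vector_derivative (z\<^sup>2 + 2 * z * of_real (a x) - of_real (b x)) * u x) (at x)"
proof -
  show "continuous_on {0..1} u"
    using assms unfolding damped_solution_def
    by (intro continuous_on_vector_derivative[of "{0..1}" u u']) auto
  show "continuous_on {0..1} u'"
    using assms unfolding damped_solution_def by auto
  show "(u has_vector_derivative u' x) (at x)" if x: "x \<in> {0<..<1}"
  proof -
    have "(u has_vector_derivative u' x) (at x within {0..1})"
      using assms x unfolding damped_solution_def by auto
    then have "(u has_vector_derivative u' x) (at x within {0<..<1})"
      by (rule has_vector_derivative_within_subset) auto
    then show ?thesis using at_within_open[OF x] by simp
  qed
  show "(u' has_vector_derivative (z\<^sup>2 + 2 * z * of_real (a x) - of_real (b x)) * u x) (at x)"
    if x: "x \<in> {0<..<1}"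
    using assms x unfolding damped_solution_def by (metis eq_iff_diff_eq_0)
qed

text \<open>Gronwall argument. With the real inner product on the complex numbers, the derivative of
  |u|^2 + |u'|^2 is at most (1 + M) 2 |u| |u'|, hence at most 1 + M times the energy itself. The
  damped energy \<open>e\<close> is therefore nonincreasing, and it starts at 0.\<close>

lemma damped_solution_zero:
  assumes "continuous_on {0..1} a" "continuous_on {0..1} b"
    and sol: "damped_solution a b z u u'" and init: "u 0 = 0" "u' 0 = 0" and "x \<in> {0..1}"
  shows "u x = 0"
proof -
  define Q where "Q = (\<lambda>x. z\<^sup>2 + 2 * z * complex_of_real (a x) - complex_of_real (b x))"
  note D = damped_solutionD[OF sol]
  have "continuous_on {0..1} Q"
    unfolding Q_def by (intro continuous_intros assms)
  then have "bounded (Q ` {0..1})"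
    by (intro compact_imp_bounded compact_continuous_image) auto
  then obtain M where M: "\<And>x. x \<in> {0..1} \<Longrightarrow> norm (Q x) \<le> M"
    unfolding bounded_iff by blast
  define e where "e = (\<lambda>x. (u x \<bullet> u x + u' x \<bullet> u' x) * exp (- (1 + M) * x))"
  have "e x \<le> e 0"
  proof (rule DERIV_nonpos_imp_decreasing_open[of 0 x e])
    show "0 \<le> x" using assms by auto
    show "continuous_on {0..x} e"
      unfolding e_def using \<open>x \<in> {0..1}\<close>
      by (intro continuous_intros continuous_on_subset[OF D(1)] continuous_on_subset[OF D(2)]) auto
    fix t assume t: "0 < t" "t < x"
    then have t': "t \<in> {0<..<1}" "t \<in> {0..1}" using assms by auto
    have u: "(u has_derivative (\<lambda>h. h *\<^sub>R u' t)) (at t)"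
      and u': "(u' has_derivative (\<lambda>h. h *\<^sub>R (Q t * u t))) (at t)"
      using D(3,4)[OF t'(1)] unfolding has_vector_derivative_def Q_def by auto
    have der_exp: "((\<lambda>x. exp (- (1 + M) * x)) has_real_derivative exp (- (1 + M) * t) * (- (1 + M))) (at t)"
      by (intro derivative_eq_intros | simp)+
    have "((\<lambda>x. u x \<bullet> u x + u' x \<bullet> u' x) has_derivative
        (\<lambda>h. (u t \<bullet> (h *\<^sub>R u' t) + (h *\<^sub>R u' t) \<bullet> u t) + (u' t \<bullet> (h *\<^sub>R (Q t * u t)) + (h *\<^sub>R (Q t * u t)) \<bullet> u' t))) (at t)"
      by (intro has_derivative_add has_derivative_inner u u')
    then have "((\<lambda>x. u x \<bullet> u x + u' x \<bullet> u' x) has_real_derivative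
        2 * (u t \<bullet> u' t) + 2 * (u' t \<bullet> (Q t * u t))) (at t)"
      unfolding has_field_derivative_def
      by (rule has_derivative_eq_rhs) (auto simp: inner_commute algebra_simps)
    then have "(e has_real_derivative
        (2 * (u t \<bullet> u' t) + 2 * (u' t \<bullet> (Q t * u t)) - (1 + M) * (u t \<bullet> u t + u' t \<bullet> u' t)) * exp (- (1 + M) * t)) (at t)"
      unfolding e_def
      by (rule DERIV_cong[OF DERIV_mult[OF _ der_exp]]) (simp add: algebra_simps)
    moreover have "2 * (u t \<bullet> u' t) + 2 * (u' t \<bullet> (Q t * u t)) - (1 + M) * (u t \<bullet> u t + u' t \<bullet> u' t) \<le> 0"
    proof -
      have "u t \<bullet> u' t \<le> norm (u t) * norm (u' t)" by (rule norm_cauchy_schwarz)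
      moreover have "u' t \<bullet> (Q t * u t) \<le> norm (u' t) * norm (Q t * u t)" by (rule norm_cauchy_schwarz)
      moreover have "norm (u' t) * norm (Q t * u t) \<le> M * (norm (u t) * norm (u' t))"
        using M[OF t'(2)] by (simp add: norm_mult mult_ac mult_right_mono)
      ultimately have "2 * (u t \<bullet> u' t) + 2 * (u' t \<bullet> (Q t * u t)) \<le> (1 + M) * (2 * norm (u t) * norm (u' t))"
        by (simp add: algebra_simps)
      also have "\<dots> \<le> (1 + M) * ((norm (u t))\<^sup>2 + (norm (u' t))\<^sup>2)"
        using M[OF t'(2)] norm_ge_zero[of "Q t"] by (intro mult_left_mono sum_squares_bound) linarith
      finally show ?thesis by (simp add: dot_square_norm)
    qed
    ultimately show "\<exists>y. (e has_real_derivative y) (at t) \<and> y \<le> 0"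
      by (blast intro: mult_nonpos_nonneg exp_ge_zero)
  qed
  then have "(u x \<bullet> u x + u' x \<bullet> u' x) * exp (- (1 + M) * x) \<le> 0"
    using init by (simp add: e_def)
  then have "u x \<bullet> u x + u' x \<bullet> u' x \<le> 0"
    by (simp add: mult_le_0_iff not_le[symmetric])
  then have "u x \<bullet> u x = 0"
    using inner_ge_zero[of "u x"] inner_ge_zero[of "u' x"] by linarith
  then show ?thesis by simp
qed

section \<open>\<open>gamma0\<close> as an entire function whose zeros are the eigenvalues\<close>

lemma gamma0_eq:
  assumes cont: "continuous_on {0..1} a" "continuous_on {0..1} b"
    and sol: "damped_solution a b z u u'" "u 0 = 0" "u' 0 = 1"
  shows "gamma0 a b z = u 1"
  unfolding gamma0_def
proof (rule the_equality)
  show "\<exists>v v'. damped_solution a b z v v' \<and> v 0 = 0 \<and> v' 0 = 1 \<and> u 1 = v 1"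
    using sol by blast
  fix w assume "\<exists>v v'. damped_solution a b z v v' \<and> v 0 = 0 \<and> v' 0 = 1 \<and> w = v 1"
  then obtain v v' where v: "damped_solution a b z v v'" "v 0 = 0" "v' 0 = 1" "w = v 1" by blast
  have "v 1 - 1 * u 1 = 0"
    by (rule damped_solution_zero[OF cont damped_solution_diff_cmult[OF v(1) sol(1)]])
       (use v sol in auto)
  then show "w = u 1" using v by simp
qed

lemma damped_solution_family:
  assumes cont: "continuous_on {0..1} a" "continuous_on {0..1} b"
  obtains U V where
    "\<And>z. damped_solution a b z (U z) (V z)" "\<And>z. U z 0 = 0" "\<And>z. V z 0 = 1"
    "(\<lambda>z. U z 1) holomorphic_on UNIV"
proof -
  \<comment> \<open>Horner form of z^2 + 2 z a - b, the shape that the rules of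
    \<open>polyfam\<close> build.\<close>
  define Q where "Q = (\<lambda>z x. z * (z * 1 + complex_of_real (2 * a x)) + complex_of_real (- b x))"
  have "polyfam Q"
    unfolding Q_def
    by (intro polyfam_add polyfam_times_param polyfam_continuous continuous_intros cont)
  then obtain U V where *: "\<And>z. U z 0 = 0" "\<And>z. V z 0 = 1"
    "\<And>z x. x \<in> {0..1} \<Longrightarrow> (U z has_vector_derivative V z x) (at x within {0..1})"
    "\<And>z x. x \<in> {0..1} \<Longrightarrow> (V z has_vector_derivative Q z x * U z x) (at x within {0..1})"
    "(\<lambda>z. U z 1) holomorphic_on UNIV"
    by (rule picard_solution) blast
  have "damped_solution a b z (U z) (V z)" for z
    unfolding damped_solution_def
  proof (intro conjI ballI)
    show "(U z has_vector_derivative V z x) (at x within {0..1})" if "x \<in> {0..1}" for x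
      using that by (rule *)
    show "continuous_on {0..1} (V z)"
      by (rule continuous_on_vector_derivative) (rule *)
    show "\<exists>u''. (V z has_vector_derivative u'') (at x) \<and>
        u'' - (z\<^sup>2 + 2 * z * of_real (a x) - of_real (b x)) * U z x = 0" if x: "x \<in> {0<..<1}" for x
    proof (intro exI conjI)
      have "(V z has_vector_derivative Q z x * U z x) (at x within {0<..<1})"
        by (rule has_vector_derivative_within_subset[OF *(4)]) (use x in auto)
      then show "(V z has_vector_derivative Q z x * U z x) (at x)"
        using at_within_open[OF x] by simp
      show "Q z x * U z x - (z\<^sup>2 + 2 * z * of_real (a x) - of_real (b x)) * U z x = 0"
        unfolding Q_def by (simp only: right_minus_eq) (simp add: power2_eq_square ring_distribs)
    qed
  qed
  from that[OF this *(1,2,5)] show ?thesis .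
qed

lemma holomorphic_gamma0:
  assumes cont: "continuous_on {0..1} a" "continuous_on {0..1} b"
  shows "gamma0 a b holomorphic_on UNIV"
proof -
  obtain U V where *: "\<And>z. damped_solution a b z (U z) (V z)" "\<And>z. U z 0 = 0" "\<And>z. V z 0 = 1"
    "(\<lambda>z. U z 1) holomorphic_on UNIV"
    by (rule damped_solution_family[OF cont], rule that)
  have "gamma0 a b = (\<lambda>z. U z 1)"
    using gamma0_eq[OF cont *(1,2,3)] by auto
  with *(4) show ?thesis by simp
qed

lemma dirichlet_eigenvalue_iff_gamma0:
  assumes cont: "continuous_on {0..1} a" "continuous_on {0..1} b"
  shows "dirichlet_eigenvalue a b z \<longleftrightarrow> gamma0 a b z = 0"
proof -
  obtain U V where UV: "damped_solution a b z U V" "U 0 = 0" "V 0 = 1"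
    by (rule damped_solution_family[OF cont], rule that)
  have g: "gamma0 a b z = U 1"
    using gamma0_eq[OF cont UV] .
  show ?thesis
  proof
    assume "dirichlet_eigenvalue a b z"
    then obtain u u' x where u: "damped_solution a b z u u'" "u 0 = 0" "u 1 = 0" "x \<in> {0..1}" "u x \<noteq> 0"
      unfolding dirichlet_eigenvalue_def by blast
    \<comment> \<open>An eigenfunction is u'(0) times the normalised solution; being nontrivial it
      has u'(0) nonzero, so u(1) = 0 forces U(1) = 0.\<close>
    have eq: "u t - u' 0 * U t = 0" if "t \<in> {0..1}" for t
      by (rule damped_solution_zero[OF cont damped_solution_diff_cmult[OF u(1) UV(1)] _ _ that])
         (use u UV in auto)
    have "u' 0 \<noteq> 0" using eq[of x] u by auto
    then show "gamma0 a b z = 0" using eq[of 1] u g by auto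
  next
    assume "gamma0 a b z = 0"
    have "\<exists>x\<in>{0..1}. U x \<noteq> 0"
    proof (rule ccontr)
      assume "\<not> ?thesis"
      then have 0: "U x = 0" if "x \<in> {0..1}" for x using that by blast
      \<comment> \<open>If U vanished on the whole interval, so would its one-sided derivative at 0,
        against V(0) = 1.\<close>
      have "(U has_vector_derivative V 0) (at 0 within {0..1})"
        using UV(1) by (auto simp: damped_solution_def)
      then have "((\<lambda>_. 0) has_vector_derivative V 0) (at 0 within {0..1})"
        using has_vector_derivative_transform[of 0 "{0..1}" "\<lambda>_. 0" U] 0 by simp
      then have "V 0 = 0"
        using vector_derivative_unique_within[of 0 "{0..1}" "\<lambda>_. 0" "V 0" 0]
        by (simp add: trivial_limit_within)
      with UV show False by simp
    qed
    with UV g \<open>gamma0 a b z = 0\<close> show "dirichlet_eigenvalue a b z"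
      unfolding dirichlet_eigenvalue_def by (intro exI[of _ U] exI[of _ V]) simp
  qed
qed

section \<open>Asymptotics for large spectral parameter\<close>

lemma norm_exp_linear_le:
  fixes z :: complex
  assumes "\<bar>q\<bar> \<le> B"
  shows "norm (exp (z * of_real p + of_real q)) \<le> exp B * exp (\<bar>Re z\<bar> * \<bar>p\<bar>)"
proof -
  have "Re z * p \<le> \<bar>Re z\<bar> * \<bar>p\<bar>" by (metis abs_ge_self abs_mult)
  moreover have "q \<le> B" using assms by simp
  ultimately have "Re z * p + q \<le> B + \<bar>Re z\<bar> * \<bar>p\<bar>" by simp
  then show ?thesis by (simp flip: exp_add)
qed

text \<open>One integration by parts gains the factor 1 / z. The prefactor exp(z + A(1)) has to stay
  with the integral: the bare integral can grow like exp(2 |Re z|) when Re z < 0, whereas the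
  product contains exp(z (1 - 2 t)) with |1 - 2 t| <= 1, which is bounded by exp |Re z| for either
  sign. In the constant, B + 2 B^2 comes from g' - 2 a g, another 2 B from the two boundary terms,
  and exp(2 B) from A.\<close>

lemma oscillatory_integral_bound:
  fixes g g' a A :: "real \<Rightarrow> real" and z :: complex
  assumes g: "\<And>x. x \<in> {0..1} \<Longrightarrow> (g has_real_derivative g' x) (at x within {0..1})"
    and A: "\<And>x. x \<in> {0..1} \<Longrightarrow> (A has_real_derivative a x) (at x within {0..1})"
    and cont: "continuous_on {0..1} a" "continuous_on {0..1} g'"
    and bound: "\<And>x. x \<in> {0..1} \<Longrightarrow> \<bar>a x\<bar> \<le> B" "\<And>x. x \<in> {0..1} \<Longrightarrow> \<bar>g x\<bar> \<le> B"
      "\<And>x. x \<in> {0..1} \<Longrightarrow> \<bar>g' x\<bar> \<le> B" "\<And>x. x \<in> {0..1} \<Longrightarrow> \<bar>A 1 - 2 * A x\<bar> \<le> 2 * B"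
  shows "norm (2 * z * (exp (z + of_real (A 1)) *
            integral {0..1} (\<lambda>t. of_real (g t) * exp (- (2 * (z * of_real t + of_real (A t)))))))
         \<le> (3 * B + 2 * B\<^sup>2) * exp (2 * B) * exp \<bar>Re z\<bar>"
proof -
  define e where "e = (\<lambda>t. exp (- (2 * (z * complex_of_real t + complex_of_real (A t)))))"
  define k where "k = exp (z + complex_of_real (A 1))"
  have cA: "continuous_on {0..1} A" and cg: "continuous_on {0..1} g"
    by (rule DERIV_continuous_on, rule A g, assumption)+
  have ce: "continuous_on {0..1} e"
    unfolding e_def by (intro continuous_intros cA)
  have B0: "B \<ge> 0" using bound(1)[of 0] by auto
  have ke: "norm (k * e t) \<le> exp (2 * B) * exp \<bar>Re z\<bar>" if "t \<in> {0..1}" for t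
  proof -
    have "k * e t = exp (z * of_real (1 - 2 * t) + of_real (A 1 - 2 * A t))"
      unfolding k_def e_def by (simp add: algebra_simps flip: exp_add)
    also have "norm \<dots> \<le> exp (2 * B) * exp (\<bar>Re z\<bar> * \<bar>1 - 2 * t\<bar>)"
      by (rule norm_exp_linear_le) (rule bound(4)[OF that])
    also have "\<dots> \<le> exp (2 * B) * exp (\<bar>Re z\<bar> * 1)"
    proof -
      have "\<bar>1 - 2 * t\<bar> \<le> 1" using that by (auto simp: abs_le_iff)
      then have "\<bar>Re z\<bar> * \<bar>1 - 2 * t\<bar> \<le> \<bar>Re z\<bar> * 1" by (rule mult_left_mono) simp
      then show ?thesis by simp
    qed
    finally show ?thesis by simp
  qed
  have ge: "((\<lambda>t. of_real (g t) * e t) has_vector_derivative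
      (of_real (g' t) - 2 * of_real (a t) * of_real (g t)) * e t - 2 * z * (of_real (g t) * e t)) (at t within {0..1})"
    if t: "t \<in> {0..1}" for t
  proof -
    have "((\<lambda>t. complex_of_real (A t)) has_vector_derivative of_real (a t)) (at t within {0..1})"
      using A[OF t] by (intro has_vector_derivative_of_real) (simp add: has_real_derivative_iff_has_vector_derivative)
    moreover have "((\<lambda>t. complex_of_real t) has_vector_derivative of_real 1) (at t within {0..1})"
      by (intro has_vector_derivative_of_real DERIV_ident)
    ultimately have "((\<lambda>t. - (2 * (z * complex_of_real t + complex_of_real (A t)))) has_vector_derivative
         - (2 * (z * of_real 1 + of_real (a t)))) (at t within {0..1})"
      by (intro has_vector_derivative_minus has_vector_derivative_mult_right has_vector_derivative_add)
    then have "(e has_vector_derivative - (2 * (z * of_real 1 + of_real (a t))) * e t) (at t within {0..1})"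
      unfolding e_def using field_vector_diff_chain_within[OF _ DERIV_subset[OF DERIV_exp]]
      by (auto simp: o_def)
    moreover have "((\<lambda>t. complex_of_real (g t)) has_vector_derivative of_real (g' t)) (at t within {0..1})"
      using g[OF t] by (intro has_vector_derivative_of_real) (simp add: has_real_derivative_iff_has_vector_derivative)
    ultimately show ?thesis
      by (rule has_vector_derivative_eq_rhs[OF has_vector_derivative_mult[rotated]]) (simp add: algebra_simps)
  qed
  have "((\<lambda>t. (of_real (g' t) - 2 * of_real (a t) * of_real (g t)) * e t - 2 * z * (of_real (g t) * e t))
      has_integral (of_real (g 1) * e 1 - of_real (g 0) * e 0)) {0..1}"
    by (rule fundamental_theorem_of_calculus) (auto intro: ge)
  then have "of_real (g 1) * e 1 - of_real (g 0) * e 0 =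
     integral {0..1} (\<lambda>t. (of_real (g' t) - 2 * of_real (a t) * of_real (g t)) * e t - 2 * z * (of_real (g t) * e t))"
    by (simp add: integral_unique)
  also have "\<dots> = integral {0..1} (\<lambda>t. (of_real (g' t) - 2 * of_real (a t) * of_real (g t)) * e t) - 2 * z * integral {0..1} (\<lambda>t. of_real (g t) * e t)"
    by (subst Henstock_Kurzweil_Integration.integral_diff)
       (auto intro!: integrable_continuous_real continuous_intros cont cg ce)
  finally have parts: "of_real (g 1) * e 1 - of_real (g 0) * e 0 = \<dots>" .
  have "2 * z * integral {0..1} (\<lambda>t. of_real (g t) * e t) =
      integral {0..1} (\<lambda>t. (of_real (g' t) - 2 * of_real (a t) * of_real (g t)) * e t) - of_real (g 1) * e 1 + of_real (g 0) * e 0"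
  proof -
    have "i = j - x + y" if "x - y = j - i" for i j x y :: complex
      using that by (simp add: algebra_simps)
    from this[OF parts] show ?thesis .
  qed
  then have "2 * z * (k * integral {0..1} (\<lambda>t. of_real (g t) * e t)) =
      k * (integral {0..1} (\<lambda>t. (of_real (g' t) - 2 * of_real (a t) * of_real (g t)) * e t) - of_real (g 1) * e 1 + of_real (g 0) * e 0)"
    by (simp only: mult.left_commute[of _ k])
  also have "\<dots> = k * integral {0..1} (\<lambda>t. (of_real (g' t) - 2 * of_real (a t) * of_real (g t)) * e t)
      - of_real (g 1) * (k * e 1) + of_real (g 0) * (k * e 0)"
    by (simp only: ring_distribs mult.left_commute[of k])
  also have "k * integral {0..1} (\<lambda>t. (of_real (g' t) - 2 * of_real (a t) * of_real (g t)) * e t)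
     = integral {0..1} (\<lambda>t. of_real (g' t - 2 * a t * g t) * (k * e t))"
    by (simp add: algebra_simps flip: integral_mult_right)
  also have "norm (integral {0..1} (\<lambda>t. of_real (g' t - 2 * a t * g t) * (k * e t))
        - of_real (g 1) * (k * e 1) + of_real (g 0) * (k * e 0))
     \<le> (B + 2 * B\<^sup>2) * (exp (2 * B) * exp \<bar>Re z\<bar>) + B * (exp (2 * B) * exp \<bar>Re z\<bar>) + B * (exp (2 * B) * exp \<bar>Re z\<bar>)"
  proof (intro order.trans[OF norm_triangle_ineq] order.trans[OF norm_triangle_ineq4] add_mono)
    show "norm (integral {0..1} (\<lambda>t. of_real (g' t - 2 * a t * g t) * (k * e t))) \<le> (B + 2 * B\<^sup>2) * (exp (2 * B) * exp \<bar>Re z\<bar>)"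
    proof (rule norm_integral_le_const)
      show "continuous_on {0..1} (\<lambda>t. complex_of_real (g' t - 2 * a t * g t) * (k * e t))"
        by (intro continuous_intros cont cg ce)
      fix t :: real assume t: "t \<in> {0..1}"
      have "\<bar>g' t - 2 * a t * g t\<bar> \<le> \<bar>g' t\<bar> + 2 * (\<bar>a t\<bar> * \<bar>g t\<bar>)"
        by (rule order.trans[OF abs_triangle_ineq4]) (simp add: abs_mult)
      also have "\<dots> \<le> B + 2 * (B * B)"
        using bound t B0 by (intro add_mono mult_left_mono mult_mono) auto
      finally have "\<bar>g' t - 2 * a t * g t\<bar> \<le> B + 2 * B\<^sup>2" by (simp add: power2_eq_square)
      then show "norm (of_real (g' t - 2 * a t * g t) * (k * e t)) \<le> (B + 2 * B\<^sup>2) * (exp (2 * B) * exp \<bar>Re z\<bar>)"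
        unfolding norm_mult[of "of_real _"] norm_of_real using ke[OF t] B0 by (intro mult_mono) auto
    qed auto
    show "norm (of_real (g 1) * (k * e 1)) \<le> B * (exp (2 * B) * exp \<bar>Re z\<bar>)"
      unfolding norm_mult[of "of_real _"] norm_of_real using ke[of 1] bound(2)[of 1] B0 by (intro mult_mono) auto
    show "norm (of_real (g 0) * (k * e 0)) \<le> B * (exp (2 * B) * exp \<bar>Re z\<bar>)"
      unfolding norm_mult[of "of_real _"] norm_of_real using ke[of 0] bound(2)[of 0] B0 by (intro mult_mono) auto
  qed
  also have "\<dots> = (3 * B + 2 * B\<^sup>2) * exp (2 * B) * exp \<bar>Re z\<bar>" by (simp add: algebra_simps)
  finally show ?thesis unfolding e_def k_def .
qed

text \<open>A single constant B bounds a, the coefficients \<alpha> and \<beta> of the diagonalised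
  equation, and the derivatives of \<alpha> and \<beta>, which the integration by parts brings
  in.\<close>

locale damped_coefficients =
  fixes a a' a'' b b' A :: "real \<Rightarrow> real" and B :: real
  assumes der_a: "\<And>x. x \<in> {0..1} \<Longrightarrow> (a has_real_derivative a' x) (at x within {0..1})"
    and der_a': "\<And>x. x \<in> {0..1} \<Longrightarrow> (a' has_real_derivative a'' x) (at x within {0..1})"
    and der_b: "\<And>x. x \<in> {0..1} \<Longrightarrow> (b has_real_derivative b' x) (at x within {0..1})"
    and cont_a'': "continuous_on {0..1} a''" and cont_b': "continuous_on {0..1} b'"
    and A_def: "A = (\<lambda>x. integral {0..x} a)"
    and B: "\<And>x. x \<in> {0..1} \<Longrightarrow> \<bar>a x\<bar> \<le> B"
      "\<And>x. x \<in> {0..1} \<Longrightarrow> \<bar>a' x - (a x)\<^sup>2 - b x\<bar> \<le> B"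
      "\<And>x. x \<in> {0..1} \<Longrightarrow> \<bar>a' x + (a x)\<^sup>2 + b x\<bar> \<le> B"
      "\<And>x. x \<in> {0..1} \<Longrightarrow> \<bar>a'' x - 2 * a x * a' x - b' x\<bar> \<le> B"
      "\<And>x. x \<in> {0..1} \<Longrightarrow> \<bar>a'' x + 2 * a x * a' x + b' x\<bar> \<le> B"
begin

text \<open>The residues of the diagonalisation: (u' + (z + a) u)' = (z + a) (u' + (z + a) u) +
  \<alpha> u and (u' - (z + a) u)' = - (z + a) (u' - (z + a) u) - \<beta> u.\<close>

definition "\<alpha> = (\<lambda>x. a' x - (a x)\<^sup>2 - b x)"
definition "\<beta> = (\<lambda>x. a' x + (a x)\<^sup>2 + b x)"

lemma B_nonneg: "B \<ge> 0"
  using B(1)[of 0] by auto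

lemma cont_a: "continuous_on {0..1} a" and cont_a': "continuous_on {0..1} a'"
  and cont_b: "continuous_on {0..1} b"
  by (rule DERIV_continuous_on, rule der_a der_a' der_b, assumption)+

lemma cont_\<alpha>: "continuous_on {0..1} \<alpha>" and cont_\<beta>: "continuous_on {0..1} \<beta>"
  unfolding \<alpha>_def \<beta>_def by (intro continuous_intros cont_a cont_a' cont_b)+

lemma der_A: "x \<in> {0..1} \<Longrightarrow> (A has_real_derivative a x) (at x within {0..1})"
  unfolding A_def has_real_derivative_iff_has_vector_derivative
  by (rule integral_has_vector_derivative[OF cont_a])

lemma cont_A: "continuous_on {0..1} A"
  by (rule DERIV_continuous_on, rule der_A)

lemma A_0 [simp]: "A 0 = 0"
  by (simp add: A_def)

lemma A_diff_le: 
  assumes "0 \<le> t" "t \<le> x" "x \<le> 1"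
  shows "\<bar>A x - A t\<bar> \<le> B"
proof -
  have "norm (A x - A t) \<le> B * norm (x - t)"
    using assms by (intro field_differentiable_bound[of "{0..1}" A a] der_A) (auto simp: B)
  also have "\<dots> \<le> B * 1"
    using assms B_nonneg by (intro mult_left_mono) auto
  finally show ?thesis by simp
qed

section \<open>The WKB exponentials and their growth\<close>

definition Ep :: "complex \<Rightarrow> real \<Rightarrow> complex" where
  "Ep z x = exp (z * of_real x + of_real (A x))"
definition Em :: "complex \<Rightarrow> real \<Rightarrow> complex" where
  "Em z x = exp (- (z * of_real x + of_real (A x)))"

lemma Ep_times_Em [simp]: "Ep z x * Em z x = 1" "Em z x * Ep z x = 1"
  unfolding Ep_def Em_def by (simp_all flip: exp_add)

lemma cont_Ep: "continuous_on {0..1} (Ep z)" and cont_Em: "continuous_on {0..1} (Em z)"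
  unfolding Ep_def Em_def by (intro continuous_intros cont_A)+

text \<open>For t <= x either kernel grows at most over the distance x - t, whatever the sign of Re
  z. This makes the Volterra estimates uniform in the direction of z.\<close>

lemma E_ratio_bound:
  assumes "0 \<le> t" "t \<le> x" "x \<le> 1"
  shows "norm (Ep z x * Em z t) \<le> exp B * exp (\<bar>Re z\<bar> * (x - t))"
    and "norm (Em z x * Ep z t) \<le> exp B * exp (\<bar>Re z\<bar> * (x - t))"
proof -
  have "Ep z x * Em z t = exp (z * of_real (x - t) + of_real (A x - A t))"
    unfolding Ep_def Em_def by (simp add: algebra_simps flip: exp_add)
  also have "norm \<dots> \<le> exp B * exp (\<bar>Re z\<bar> * \<bar>x - t\<bar>)"
    by (rule norm_exp_linear_le[OF A_diff_le[OF assms]])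
  finally show "norm (Ep z x * Em z t) \<le> exp B * exp (\<bar>Re z\<bar> * (x - t))" using assms by simp
  have "Em z x * Ep z t = exp (z * of_real (t - x) + of_real (A t - A x))"
    unfolding Ep_def Em_def by (simp add: algebra_simps flip: exp_add)
  also have "norm \<dots> \<le> exp B * exp (\<bar>Re z\<bar> * \<bar>t - x\<bar>)"
    using A_diff_le[OF assms] by (intro norm_exp_linear_le) (simp add: abs_minus_commute)
  finally show "norm (Em z x * Ep z t) \<le> exp B * exp (\<bar>Re z\<bar> * (x - t))" using assms by simp
qed

lemma E_bound:
  assumes "x \<in> {0..1}"
  shows "norm (Ep z x) \<le> exp B * exp (\<bar>Re z\<bar> * x)" "norm (Em z x) \<le> exp B * exp (\<bar>Re z\<bar> * x)"
  using E_ratio_bound[of 0 x z] assms by (auto simp: Ep_def Em_def)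

lemma E_derivative:
  assumes "x \<in> {0<..<1}"
  shows "(Ep z has_vector_derivative (z + of_real (a x)) * Ep z x) (at x)"
    and "(Em z has_vector_derivative - (z + of_real (a x)) * Em z x) (at x)"
proof -
  have "(A has_real_derivative a x) (at x)"
  proof -
    have "(A has_real_derivative a x) (at x within {0<..<1})"
      using der_A[of x] assms by (auto intro: DERIV_subset)
    then show ?thesis using at_within_open[OF assms] by simp
  qed
  then have "((\<lambda>t. complex_of_real (A t)) has_vector_derivative of_real (a x)) (at x)"
    by (intro has_vector_derivative_of_real) (simp add: has_real_derivative_iff_has_vector_derivative)
  moreover have "((\<lambda>t. complex_of_real t) has_vector_derivative of_real 1) (at x)"
    by (intro has_vector_derivative_of_real DERIV_ident)
  ultimately have *: "((\<lambda>t. z * complex_of_real t + complex_of_real (A t)) has_vector_derivative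
       z * of_real 1 + of_real (a x)) (at x)"
    by (intro has_vector_derivative_mult_right has_vector_derivative_add)
  show "(Ep z has_vector_derivative (z + of_real (a x)) * Ep z x) (at x)"
    using field_vector_diff_chain_at[OF * DERIV_exp] by (simp add: o_def Ep_def[abs_def])
  show "(Em z has_vector_derivative - (z + of_real (a x)) * Em z x) (at x)"
    using field_vector_diff_chain_at[OF has_vector_derivative_minus[OF *] DERIV_exp]
    by (simp add: o_def Em_def[abs_def])
qed


context
  fixes z :: complex and u u' :: "real \<Rightarrow> complex"
  assumes sol: "damped_solution a b z u u'" and init: "u 0 = 0" "u' 0 = 1"
begin

lemma cont_u: "continuous_on {0..1} u"
  using damped_solutionD(1)[OF sol] .

text \<open>The combinations $u' \pm (z + a) u$ diagonalise the equation up to terms without a factor $z$.\<close>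

lemma volterra:
  assumes x: "x \<in> {0..1}"
  shows "2 * (z + of_real (a x)) * u x = Ep z x - Em z x
     + Ep z x * integral {0..x} (\<lambda>t. of_real (\<alpha> t) * u t * Em z t)
     + Em z x * integral {0..x} (\<lambda>t. of_real (\<beta> t) * u t * Ep z t)"
proof -
  note D = damped_solutionD[OF sol]
  \<comment> \<open>P and R are u' + (z + a) u and u' - (z + a) u times the integrating factors that
    remove the diagonal part, so only the residues are left to integrate.\<close>
  define P where "P = (\<lambda>t. (u' t + (z + of_real (a t)) * u t) * Em z t)"
  define R where "R = (\<lambda>t. (u' t - (z + of_real (a t)) * u t) * Ep z t)"
  have sub: "{0..x} \<subseteq> {0..1}" using x by auto
  have contP: "continuous_on {0..x} P" and contR: "continuous_on {0..x} R"
    unfolding P_def R_def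
    by (rule continuous_on_subset[OF _ sub], intro continuous_intros D cont_a cont_Ep cont_Em)+
  have der: "((\<lambda>t. (z + of_real (a t)) * u t) has_vector_derivative
       (z + of_real (a t)) * u' t + of_real (a' t) * u t) (at t)" if t: "t \<in> {0<..<1}" for t
  proof -
    have "(a has_real_derivative a' t) (at t within {0<..<1})"
      using der_a[of t] t by (auto intro: DERIV_subset)
    then have "(a has_real_derivative a' t) (at t)"
      using at_within_open[OF t] by simp
    then have "((\<lambda>t. z + complex_of_real (a t)) has_vector_derivative 0 + of_real (a' t)) (at t)"
      by (intro has_vector_derivative_add has_vector_derivative_const has_vector_derivative_of_real)
    from has_vector_derivative_mult[OF this D(3)[OF t]] show ?thesis by simp
  qed
  have "((\<lambda>t. of_real (\<alpha> t) * u t * Em z t) has_integral P x - P 0) {0..x}"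
  \<comment> \<open>The equation is available in the open interval only; continuity of P covers the
    endpoints.\<close>
  proof (rule fundamental_theorem_of_calculus_interior)
    fix t assume "t \<in> {0<..<x}"
    then have t: "t \<in> {0<..<1}" using x by auto
    show "(P has_vector_derivative of_real (\<alpha> t) * u t * Em z t) (at t)"
      unfolding P_def
      by (rule has_vector_derivative_eq_rhs[OF has_vector_derivative_mult[OF
            has_vector_derivative_add[OF D(4)[OF t] der[OF t]] E_derivative(2)[OF t]]])
         (simp add: \<alpha>_def algebra_simps power2_eq_square)
  qed (use x contP in auto)
  moreover have "P 0 = 1" by (simp add: P_def init Em_def)
  ultimately have P: "P x = 1 + integral {0..x} (\<lambda>t. of_real (\<alpha> t) * u t * Em z t)"
    by (simp add: integral_unique)
  have "((\<lambda>t. - (of_real (\<beta> t) * u t * Ep z t)) has_integral R x - R 0) {0..x}"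
  proof (rule fundamental_theorem_of_calculus_interior)
    fix t assume "t \<in> {0<..<x}"
    then have t: "t \<in> {0<..<1}" using x by auto
    show "(R has_vector_derivative - (of_real (\<beta> t) * u t * Ep z t)) (at t)"
      unfolding R_def
      by (rule has_vector_derivative_eq_rhs[OF has_vector_derivative_mult[OF
            has_vector_derivative_diff[OF D(4)[OF t] der[OF t]] E_derivative(1)[OF t]]])
         (simp add: \<beta>_def algebra_simps power2_eq_square)
  qed (use x contR in auto)
  moreover have "R 0 = 1" by (simp add: R_def init Ep_def)
  ultimately have "((\<lambda>t. - (of_real (\<beta> t) * u t * Ep z t)) has_integral R x - 1) {0..x}" by simp
  then have "integral {0..x} (\<lambda>t. - (of_real (\<beta> t) * u t * Ep z t)) = R x - 1" by (rule integral_unique)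
  then have R: "R x = 1 - integral {0..x} (\<lambda>t. of_real (\<beta> t) * u t * Ep z t)"
    by (simp add: algebra_simps)
  \<comment> \<open>Undoing the integrating factors and subtracting cancels u'.\<close>
  have "2 * (z + of_real (a x)) * u x = Ep z x * P x - Em z x * R x"
  proof -
    have "Ep z x * P x = (u' x + (z + of_real (a x)) * u x) * (Ep z x * Em z x)"
      by (simp only: P_def mult_ac)
    moreover have "Em z x * R x = (u' x - (z + of_real (a x)) * u x) * (Ep z x * Em z x)"
      by (simp only: R_def mult_ac)
    ultimately show ?thesis by simp
  qed
  also have "\<dots> = Ep z x - Em z x
     + Ep z x * integral {0..x} (\<lambda>t. of_real (\<alpha> t) * u t * Em z t)
     + Em z x * integral {0..x} (\<lambda>t. of_real (\<beta> t) * u t * Ep z t)"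
    unfolding P R by (simp add: algebra_simps)
  finally show ?thesis .
qed

end

text \<open>The kernel grows over x - t and f over t, so the integrand is bounded by the weight at
  x, uniformly in t. The integral operators thus preserve the weight exp(|Re z| x).\<close>

lemma weighted_integral_bound:
  fixes f :: "real \<Rightarrow> complex"
  assumes cont: "continuous_on {0..1} f" and x: "x \<in> {0..1}"
    and f: "\<And>t. t \<in> {0..1} \<Longrightarrow> norm (f t) \<le> S * exp (\<bar>Re z\<bar> * t)"
  shows "norm (Ep z x * integral {0..x} (\<lambda>t. of_real (\<alpha> t) * f t * Em z t)) \<le> B * exp B * S * exp (\<bar>Re z\<bar> * x)" (is ?th1)
    and "norm (Em z x * integral {0..x} (\<lambda>t. of_real (\<beta> t) * f t * Ep z t)) \<le> B * exp B * S * exp (\<bar>Re z\<bar> * x)" (is ?th2)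
proof -
  have gen: "norm (c * e t * (of_real g * f t)) \<le> B * exp B * S * exp (\<bar>Re z\<bar> * x)"
    if t: "t \<in> {0..x}" and "norm (c * e t) \<le> exp B * exp (\<bar>Re z\<bar> * (x - t))" "\<bar>g\<bar> \<le> B"
    for c :: complex and e :: "real \<Rightarrow> complex" and g t
  proof -
    have "t \<in> {0..1}" using t x by auto
    then have "norm (c * e t) * (\<bar>g\<bar> * norm (f t)) \<le> (exp B * exp (\<bar>Re z\<bar> * (x - t))) * (B * (S * exp (\<bar>Re z\<bar> * t)))"
      using that f B_nonneg by (intro mult_mono) auto
    also have "\<dots> = B * exp B * S * (exp (\<bar>Re z\<bar> * (x - t)) * exp (\<bar>Re z\<bar> * t))" by simp
    also have "exp (\<bar>Re z\<bar> * (x - t)) * exp (\<bar>Re z\<bar> * t) = exp (\<bar>Re z\<bar> * x)"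
      by (simp add: algebra_simps flip: exp_add)
    finally show ?thesis by (simp add: norm_mult)
  qed
  have "norm (integral {0..x} (\<lambda>t. Ep z x * Em z t * (of_real (\<alpha> t) * f t))) \<le> B * exp B * S * exp (\<bar>Re z\<bar> * x)"
    using x by (intro norm_integral_le_const gen continuous_intros cont cont_Em cont_\<alpha> E_ratio_bound)
      (auto simp: \<alpha>_def B)
  then show ?th1 by (simp add: mult_ac flip: integral_mult_right)
  have "norm (integral {0..x} (\<lambda>t. Em z x * Ep z t * (of_real (\<beta> t) * f t))) \<le> B * exp B * S * exp (\<bar>Re z\<bar> * x)"
    using x by (intro norm_integral_le_const gen continuous_intros cont cont_Ep cont_\<beta> E_ratio_bound)
      (auto simp: \<beta>_def B)
  then show ?th2 by (simp add: mult_ac flip: integral_mult_right)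
qed

section \<open>Expansion of the normalised solution to second order\<close>

context
  fixes z :: complex and u u' :: "real \<Rightarrow> complex"
  assumes sol: "damped_solution a b z u u'" and init: "u 0 = 0" "u' 0 = 1"
    and large: "norm z \<ge> 2 * B * (1 + exp B)" "norm z > 0"
begin

text \<open>A priori estimate at the point \<open>x0\<close> where the weighted modulus of u attains
  its maximum S. There the Volterra equation gives |z| S <= exp B + B (1 + exp B) S, and the lower
  bound on |z| makes the last term at most |z| S / 2.\<close>

lemma solution_bound:
  assumes x: "x \<in> {0..1}"
  shows "norm (u x) \<le> 2 * exp B / norm z * exp (\<bar>Re z\<bar> * x)"
proof -
  note cu = cont_u[OF sol init]
  have "continuous_on {0..1} (\<lambda>t. norm (u t) * exp (- (\<bar>Re z\<bar> * t)))"
    by (intro continuous_intros cu)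
  then obtain x0 where x0: "x0 \<in> {0..1}"
    "\<And>t. t \<in> {0..1} \<Longrightarrow> norm (u t) * exp (- (\<bar>Re z\<bar> * t)) \<le> norm (u x0) * exp (- (\<bar>Re z\<bar> * x0))"
    using continuous_attains_sup[of "{0..1::real}" "\<lambda>t. norm (u t) * exp (- (\<bar>Re z\<bar> * t))"] by auto
  define S where "S = norm (u x0) * exp (- (\<bar>Re z\<bar> * x0))"
  have S: "norm (u t) \<le> S * exp (\<bar>Re z\<bar> * t)" if "t \<in> {0..1}" for t
  proof -
    have "norm (u t) * exp (- (\<bar>Re z\<bar> * t)) \<le> S" using x0(2)[OF that] by (simp only: S_def)
    then show ?thesis by (simp add: exp_minus field_simps)
  qed
  have "S \<ge> 0" by (simp add: S_def)
  have "norm (2 * (z + of_real (a x0)) * u x0) \<le> exp B * exp (\<bar>Re z\<bar> * x0) + exp B * exp (\<bar>Re z\<bar> * x0)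
      + B * exp B * S * exp (\<bar>Re z\<bar> * x0) + B * exp B * S * exp (\<bar>Re z\<bar> * x0)"
    unfolding volterra[OF sol init x0(1)]
    by (intro order.trans[OF norm_triangle_ineq] order.trans[OF norm_triangle_ineq4] add_mono
          weighted_integral_bound E_bound cu S x0)
  also have "\<dots> = 2 * (exp B * (1 + B * S)) * exp (\<bar>Re z\<bar> * x0)" by (simp add: algebra_simps)
  also have "norm (2 * (z + of_real (a x0)) * u x0) = 2 * norm (z + of_real (a x0)) * S * exp (\<bar>Re z\<bar> * x0)"
    unfolding norm_mult S_def by (simp add: exp_minus)
  finally have "norm (z + of_real (a x0)) * S \<le> exp B * (1 + B * S)" by simp
  moreover have "norm z - B \<le> norm (z + of_real (a x0))"
    using norm_diff_ineq[of z "of_real (a x0)"] B(1)[OF x0(1)] by simp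
  ultimately have "(norm z - B) * S \<le> exp B * (1 + B * S)"
    using \<open>S \<ge> 0\<close> by (meson mult_right_mono order.trans)
  then have "norm z * S \<le> exp B + (B * (1 + exp B)) * S" by (simp add: algebra_simps)
  moreover have "(B * (1 + exp B)) * S \<le> norm z / 2 * S"
    using large \<open>S \<ge> 0\<close> by (intro mult_right_mono) auto
  ultimately have "S \<le> 2 * exp B / norm z" using large(2) by (simp add: field_simps)
  then show ?thesis
    by (intro order.trans[OF S[OF x]] mult_right_mono) auto
qed

text \<open>Half the sum of the bounds for the two integrals and for 2 a u, times |z|, once u is
  estimated by \<open>solution_bound\<close>.\<close>

definition "D1 = 2 * B * exp B * (1 + exp B)"

lemma solution_first_order:
  assumes x: "x \<in> {0..1}"
  shows "norm (z * u x - (Ep z x - Em z x) / 2) \<le> D1 / norm z * exp (\<bar>Re z\<bar> * x)"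
proof -
  note cu = cont_u[OF sol init]
  define S where "S = 2 * exp B / norm z"
  note S = solution_bound[folded S_def]
  have "2 * (z * u x - (Ep z x - Em z x) / 2) = Ep z x * integral {0..x} (\<lambda>t. of_real (\<alpha> t) * u t * Em z t)
     + Em z x * integral {0..x} (\<lambda>t. of_real (\<beta> t) * u t * Ep z t) - of_real (2 * a x) * u x"
    using volterra[OF sol init x] by (simp add: algebra_simps diff_divide_distrib)
  also have "norm \<dots> \<le> B * exp B * S * exp (\<bar>Re z\<bar> * x) + B * exp B * S * exp (\<bar>Re z\<bar> * x)
      + 2 * B * (S * exp (\<bar>Re z\<bar> * x))"
  proof (intro order.trans[OF norm_triangle_ineq4] order.trans[OF norm_triangle_ineq] add_mono
          weighted_integral_bound cu S x)
    show "norm (of_real (2 * a x) * u x) \<le> 2 * B * (S * exp (\<bar>Re z\<bar> * x))"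
      unfolding norm_mult[of "of_real _"] norm_of_real
      using B(1)[OF x] S[OF x] B_nonneg by (intro mult_mono) auto
  qed
  also have "\<dots> = 2 * (D1 / norm z * exp (\<bar>Re z\<bar> * x))"
    by (simp add: S_def D1_def algebra_simps add_divide_distrib)
  finally show ?thesis by (simp only: norm_mult) simp
qed

text \<open>The summands stem from the term a(1) r(1), from the integrals \<open>I1\<close> and
  \<open>I2\<close> of the first-order remainder r, and, rounded up, from the oscillating integrals
  \<open>O1\<close> and \<open>O2\<close> of \<open>solution_second_order\<close>.\<close>

definition "D2 = D1 * B + B * exp B * D1 + (3 * B + 2 * B\<^sup>2) * exp (2 * B) / 2"
text \<open>Since a' integrates to a(1) - a(0), this is half the integral of a^2 + b. It is the part
  of the integrals of \<alpha> and \<beta> that enters with opposite signs and hence multiplies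
  cosh.\<close>

definition "K = (integral {0..1} \<beta> - (a 1 - a 0)) / 2"

lemma integral_\<alpha>: "integral {0..1} \<alpha> = (a 1 - a 0) - 2 * K"
proof -
  have "integral {0..1} \<alpha> + integral {0..1} \<beta> = integral {0..1} (\<lambda>x. 2 * a' x)"
    by (subst Henstock_Kurzweil_Integration.integral_add[symmetric,
          OF integrable_continuous_real[OF cont_\<alpha>] integrable_continuous_real[OF cont_\<beta>]])
       (simp add: \<alpha>_def \<beta>_def)
  also have "\<dots> = 2 * (a 1 - a 0)"
  proof -
    have "(a' has_integral a 1 - a 0) {0..1}"
      by (rule fundamental_theorem_of_calculus)
         (auto simp flip: has_real_derivative_iff_has_vector_derivative intro: der_a)
    then show ?thesis by (simp add: integral_unique)
  qed
  finally show ?thesis by (simp add: K_def field_simps)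
qed

lemma of_real_integral:
  fixes f :: "real \<Rightarrow> real"
  assumes "continuous_on {0..1} f"
  shows "integral {0..1} (\<lambda>x. complex_of_real (f x)) = of_real (integral {0..1} f)"
  by (rule integral_unique has_integral_of_real integrable_integral integrable_continuous_real assms)+

text \<open>Inserting z u = (Ep - Em) / 2 + r into the integrals leaves three kinds of terms:
  integrals of r, of size 1 / z; integrals against \<open>Em\<close> squared or \<open>Ep\<close>
  squared, which oscillate and are of size 1 / z; and the plain integrals of \<alpha> / 2 and
  \<beta> / 2. The latter contribute (a(1) - a(0)) / 2 to the coefficient of sinh, from which the
  a(1) of the left side is subtracted; this is how the mean of a(0) and a(1) appears.\<close>

lemma solution_second_order:
  "norm (z * (z * u 1 - (Ep z 1 - Em z 1) / 2)
      + of_real ((a 0 + a 1) / 2) * ((Ep z 1 - Em z 1) / 2) + of_real K * ((Ep z 1 + Em z 1) / 2))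
   \<le> D2 / norm z * exp \<bar>Re z\<bar>"
proof -
  note cu = cont_u[OF sol init]
  define r where "r = (\<lambda>t. z * u t - (Ep z t - Em z t) / 2)"
  have r: "norm (r t) \<le> D1 / norm z * exp (\<bar>Re z\<bar> * t)" if "t \<in> {0..1}" for t
    using solution_first_order[OF that] by (simp only: r_def)
  have cr: "continuous_on {0..1} r"
    unfolding r_def by (intro continuous_intros cu cont_Ep cont_Em) auto
  define O1 where "O1 = Ep z 1 * integral {0..1} (\<lambda>t. of_real (\<alpha> t) * (Em z t)\<^sup>2)"
  define O2 where "O2 = Em z 1 * integral {0..1} (\<lambda>t. of_real (\<beta> t) * (Ep z t)\<^sup>2)"
  define I1 where "I1 = Ep z 1 * integral {0..1} (\<lambda>t. of_real (\<alpha> t) * r t * Em z t)"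
  define I2 where "I2 = Em z 1 * integral {0..1} (\<lambda>t. of_real (\<beta> t) * r t * Ep z t)"
  have zu: "z * u t = r t + (Ep z t - Em z t) / 2" for t by (simp add: r_def)
  have "z * integral {0..1} (\<lambda>t. of_real (\<alpha> t) * u t * Em z t) =
        integral {0..1} (\<lambda>t. of_real (\<alpha> t) * r t * Em z t + (of_real (\<alpha> t) / 2 - of_real (\<alpha> t) * (Em z t)\<^sup>2 / 2))"
  proof -
    have "z * (of_real (\<alpha> t) * u t * Em z t) = of_real (\<alpha> t) * r t * Em z t + (of_real (\<alpha> t) / 2 - of_real (\<alpha> t) * (Em z t)\<^sup>2 / 2)" for t
    proof -
      have "z * (of_real (\<alpha> t) * u t * Em z t) = of_real (\<alpha> t) * Em z t * (z * u t)" by (simp only: mult_ac)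
      also have "\<dots> = of_real (\<alpha> t) * r t * Em z t + of_real (\<alpha> t) / 2 * (Ep z t * Em z t) - of_real (\<alpha> t) * (Em z t)\<^sup>2 / 2"
        unfolding zu by (simp only: power2_eq_square) (simp add: field_simps del: Ep_times_Em)
      finally show ?thesis by simp
    qed
    then show ?thesis by (simp flip: integral_mult_right)
  qed
  also have "\<dots> = integral {0..1} (\<lambda>t. of_real (\<alpha> t) * r t * Em z t) +
      (integral {0..1} (\<lambda>t. of_real (\<alpha> t) / 2) - integral {0..1} (\<lambda>t. of_real (\<alpha> t) * (Em z t)\<^sup>2 / 2))"
    by (subst Henstock_Kurzweil_Integration.integral_add Henstock_Kurzweil_Integration.integral_diff,
        (intro integrable_continuous_real continuous_intros cont_\<alpha> cr cont_Em; simp)+)+ simp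
  finally have eq1: "z * integral {0..1} (\<lambda>t. of_real (\<alpha> t) * u t * Em z t) = \<dots>" .
  have zI1: "z * (Ep z 1 * integral {0..1} (\<lambda>t. of_real (\<alpha> t) * u t * Em z t)) =
      I1 + Ep z 1 * of_real (integral {0..1} \<alpha>) / 2 - O1 / 2"
    unfolding mult.left_commute[of z "Ep z 1"] eq1
    by (simp add: I1_def O1_def of_real_integral[OF cont_\<alpha>] algebra_simps)
  have "z * integral {0..1} (\<lambda>t. of_real (\<beta> t) * u t * Ep z t) =
        integral {0..1} (\<lambda>t. of_real (\<beta> t) * r t * Ep z t + (of_real (\<beta> t) * (Ep z t)\<^sup>2 / 2 - of_real (\<beta> t) / 2))"
  proof -
    have "z * (of_real (\<beta> t) * u t * Ep z t) = of_real (\<beta> t) * r t * Ep z t + (of_real (\<beta> t) * (Ep z t)\<^sup>2 / 2 - of_real (\<beta> t) / 2)" for t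
    proof -
      have "z * (of_real (\<beta> t) * u t * Ep z t) = of_real (\<beta> t) * Ep z t * (z * u t)" by (simp only: mult_ac)
      also have "\<dots> = of_real (\<beta> t) * r t * Ep z t + of_real (\<beta> t) * (Ep z t)\<^sup>2 / 2 - of_real (\<beta> t) / 2 * (Ep z t * Em z t)"
        unfolding zu by (simp only: power2_eq_square) (simp add: field_simps del: Ep_times_Em)
      finally show ?thesis by simp
    qed
    then show ?thesis by (simp flip: integral_mult_right)
  qed
  also have "\<dots> = integral {0..1} (\<lambda>t. of_real (\<beta> t) * r t * Ep z t) +
      (integral {0..1} (\<lambda>t. of_real (\<beta> t) * (Ep z t)\<^sup>2 / 2) - integral {0..1} (\<lambda>t. of_real (\<beta> t) / 2))"
    by (subst Henstock_Kurzweil_Integration.integral_add Henstock_Kurzweil_Integration.integral_diff,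
        (intro integrable_continuous_real continuous_intros cont_\<beta> cr cont_Ep; simp)+)+ simp
  finally have eq2: "z * integral {0..1} (\<lambda>t. of_real (\<beta> t) * u t * Ep z t) = \<dots>" .
  have zI2: "z * (Em z 1 * integral {0..1} (\<lambda>t. of_real (\<beta> t) * u t * Ep z t)) =
      I2 + O2 / 2 - Em z 1 * of_real (integral {0..1} \<beta>) / 2"
    unfolding mult.left_commute[of z "Em z 1"] eq2
    by (simp add: I2_def O2_def of_real_integral[OF cont_\<beta>] algebra_simps)
  have O1: "norm (2 * z * O1) \<le> (3 * B + 2 * B\<^sup>2) * exp (2 * B) * exp \<bar>Re z\<bar>"
  proof -
    have "norm (2 * z * (exp (z + of_real (A 1)) *
            integral {0..1} (\<lambda>t. of_real (\<alpha> t) * exp (- (2 * (z * of_real t + of_real (A t)))))))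
         \<le> (3 * B + 2 * B\<^sup>2) * exp (2 * B) * exp \<bar>Re z\<bar>"
    proof (rule oscillatory_integral_bound[where a = a and g' = "\<lambda>x. a'' x - 2 * a x * a' x - b' x"])
      show "(\<alpha> has_real_derivative a'' x - 2 * a x * a' x - b' x) (at x within {0..1})" if "x \<in> {0..1}" for x
        unfolding \<alpha>_def by (auto intro!: derivative_eq_intros der_a der_a' der_b that simp: that)
      show "\<bar>A 1 - 2 * A x\<bar> \<le> 2 * B" if "x \<in> {0..1}" for x
        using A_diff_le[of x 1] A_diff_le[of 0 x] that by simp
    qed (use B in \<open>auto simp: \<alpha>_def intro!: der_A cont_a cont_a' cont_a'' cont_b' continuous_intros\<close>)
    then show ?thesis by (simp add: O1_def Ep_def Em_def power2_eq_square flip: exp_add)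
  qed
  have O2: "norm (2 * z * O2) \<le> (3 * B + 2 * B\<^sup>2) * exp (2 * B) * exp \<bar>Re z\<bar>"
  proof -
    \<comment> \<open>The same estimate at -z and -A, because \<open>Ep\<close> squared is exp(2 (z
      t + A(t))).\<close>
    have "norm (2 * (- z) * (exp (- z + of_real (- A 1)) *
            integral {0..1} (\<lambda>t. of_real (\<beta> t) * exp (- (2 * (- z * of_real t + of_real (- A t)))))))
         \<le> (3 * B + 2 * B\<^sup>2) * exp (2 * B) * exp \<bar>Re (- z)\<bar>"
    proof (rule oscillatory_integral_bound[where a = "\<lambda>x. - a x" and A = "\<lambda>x. - A x" and g' = "\<lambda>x. a'' x + 2 * a x * a' x + b' x"])
      show "(\<beta> has_real_derivative a'' x + 2 * a x * a' x + b' x) (at x within {0..1})" if "x \<in> {0..1}" for x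
        unfolding \<beta>_def by (auto intro!: derivative_eq_intros der_a der_a' der_b that simp: that)
      show "\<bar>- A 1 - 2 * - A x\<bar> \<le> 2 * B" if "x \<in> {0..1}" for x
        using A_diff_le[of x 1] A_diff_le[of 0 x] that by simp
    qed (use B in \<open>auto simp: \<beta>_def intro!: der_A cont_a cont_a' cont_a'' cont_b' continuous_intros DERIV_minus\<close>)
    then show ?thesis by (simp add: O2_def Ep_def Em_def power2_eq_square algebra_simps flip: exp_add)
  qed
  have I: "norm I1 \<le> B * exp B * (D1 / norm z) * exp \<bar>Re z\<bar>" "norm I2 \<le> B * exp B * (D1 / norm z) * exp \<bar>Re z\<bar>"
    unfolding I1_def I2_def
    using weighted_integral_bound[OF cr _ r, of 1] by simp_all
  have D1: "D1 \<ge> 0" using B_nonneg by (simp add: D1_def)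
  have "2 * (z * (z * u 1 - (Ep z 1 - Em z 1) / 2)
      + of_real ((a 0 + a 1) / 2) * ((Ep z 1 - Em z 1) / 2) + of_real K * ((Ep z 1 + Em z 1) / 2))
     = - (2 * of_real (a 1) * r 1) + (I1 - O1 / 2) + (I2 + O2 / 2)" (is "2 * ?L = ?R")
  proof -
    have "2 * z * (z * u 1) + 2 * of_real (a 1) * (z * u 1) = z * (2 * (z + of_real (a 1)) * u 1)"
      by (simp add: algebra_simps)
    also have "\<dots> = z * (Ep z 1 - Em z 1) + z * (Ep z 1 * integral {0..1} (\<lambda>t. of_real (\<alpha> t) * u t * Em z t))
        + z * (Em z 1 * integral {0..1} (\<lambda>t. of_real (\<beta> t) * u t * Ep z t))"
      by (subst volterra[OF sol init]) (simp_all add: algebra_simps)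
    finally have "2 * z * (z * u 1) + 2 * of_real (a 1) * (z * u 1) = z * (Ep z 1 - Em z 1)
       + (I1 + Ep z 1 * of_real (integral {0..1} \<alpha>) / 2 - O1 / 2)
       + (I2 + O2 / 2 - Em z 1 * of_real (integral {0..1} \<beta>) / 2)"
      unfolding zI1 zI2 .
    moreover have "integral {0..1} \<beta> = (a 1 - a 0) + 2 * K" by (simp add: K_def field_simps)
    ultimately have *: "2 * z * (z * u 1) + 2 * of_real (a 1) * (z * u 1) = z * (Ep z 1 - Em z 1)
       + (I1 + Ep z 1 * of_real ((a 1 - a 0) - 2 * K) / 2 - O1 / 2)
       + (I2 + O2 / 2 - Em z 1 * of_real ((a 1 - a 0) + 2 * K) / 2)"
      unfolding integral_\<alpha> by (simp only:)
    have "2 * ?L - ?R = 2 * z * (z * u 1) + 2 * of_real (a 1) * (z * u 1) - (z * (Ep z 1 - Em z 1)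
       + (I1 + Ep z 1 * of_real ((a 1 - a 0) - 2 * K) / 2 - O1 / 2)
       + (I2 + O2 / 2 - Em z 1 * of_real ((a 1 - a 0) + 2 * K) / 2))"
      unfolding r_def by (simp add: field_simps)
    also have "\<dots> = 0" unfolding * by (rule diff_self)
    finally show ?thesis by simp
  qed
  then have "2 * norm ?L = norm ?R" by (metis norm_mult norm_numeral)
  also have "\<dots> \<le> 2 * B * (D1 / norm z * exp \<bar>Re z\<bar>)
      + (B * exp B * (D1 / norm z) * exp \<bar>Re z\<bar> + (3 * B + 2 * B\<^sup>2) * exp (2 * B) / 2 / norm z * exp \<bar>Re z\<bar> / 2)
      + (B * exp B * (D1 / norm z) * exp \<bar>Re z\<bar> + (3 * B + 2 * B\<^sup>2) * exp (2 * B) / 2 / norm z * exp \<bar>Re z\<bar> / 2)"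
  proof (intro order.trans[OF norm_triangle_ineq] order.trans[OF norm_triangle_ineq4] add_mono I)
    show "norm (- (2 * of_real (a 1) * r 1)) \<le> 2 * B * (D1 / norm z * exp \<bar>Re z\<bar>)"
    proof -
      have "2 * (\<bar>a 1\<bar> * norm (r 1)) \<le> 2 * (B * (D1 / norm z * exp \<bar>Re z\<bar>))"
        using B(1)[of 1] r[of 1] B_nonneg by (intro mult_left_mono mult_mono) auto
      then show ?thesis by (simp add: norm_mult)
    qed
    show "norm (O1 / 2) \<le> (3 * B + 2 * B\<^sup>2) * exp (2 * B) / 2 / norm z * exp \<bar>Re z\<bar> / 2"
      using O1 large(2) by (simp add: norm_mult norm_divide field_simps)
    show "norm (O2 / 2) \<le> (3 * B + 2 * B\<^sup>2) * exp (2 * B) / 2 / norm z * exp \<bar>Re z\<bar> / 2"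
      using O2 large(2) by (simp add: norm_mult norm_divide field_simps)
  qed
  also have "\<dots> = 2 * ((D1 * B + B * exp B * D1 + (3 * B + 2 * B\<^sup>2) * exp (2 * B) / 2 / 2) / norm z * exp \<bar>Re z\<bar>)"
    using large(2) by (simp add: field_simps)
  also have "\<dots> \<le> 2 * (D2 / norm z * exp \<bar>Re z\<bar>)"
    unfolding D2_def using B_nonneg by (intro mult_left_mono mult_right_mono divide_right_mono) auto
  finally show ?thesis by simp
qed

end

theorem gamma0_asymptotics:
  "\<exists>K C \<rho>. \<forall>z. norm z \<ge> \<rho> \<longrightarrow>
     norm (z * (z * gamma0 a b z - sinh (z + of_real (A 1)))
       + of_real ((a 0 + a 1) / 2) * sinh (z + of_real (A 1)) + of_real K * cosh (z + of_real (A 1)))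
     \<le> C / norm z * exp \<bar>Re z\<bar>"
proof (intro exI allI impI)
  \<comment> \<open>The 1 in the threshold ensures that z is nonzero; the other entry is what
    \<open>solution_bound\<close> requires.\<close>
  fix z :: complex assume z: "norm z \<ge> max 1 (2 * B * (1 + exp B))"
  obtain U V where UV: "damped_solution a b z U V" "U 0 = 0" "V 0 = 1"
    by (rule damped_solution_family[OF cont_a cont_b], rule that)
  have E: "(Ep z 1 - Em z 1) / 2 = sinh (z + of_real (A 1))" "(Ep z 1 + Em z 1) / 2 = cosh (z + of_real (A 1))"
    by (simp_all add: Ep_def Em_def sinh_field_def cosh_field_def)
  show "norm (z * (z * gamma0 a b z - sinh (z + of_real (A 1)))
       + of_real ((a 0 + a 1) / 2) * sinh (z + of_real (A 1)) + of_real K * cosh (z + of_real (A 1)))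
     \<le> D2 / norm z * exp \<bar>Re z\<bar>"
  proof -
    have large: "norm z \<ge> 2 * B * (1 + exp B)" "norm z > 0" using z by auto
    show ?thesis
      using solution_second_order[OF UV large] unfolding E gamma0_eq[OF cont_a cont_b UV] .
  qed
qed

end

section \<open>The hyperbolic sine on large circles\<close>

text \<open>The reflection w -> -w maps the circle onto itself, shifted by half a turn, and changes
  the sign of dw.\<close>

lemma contour_integral_even_circlepath:
  fixes f :: "complex \<Rightarrow> complex"
  assumes "\<And>w. f (- w) = f w"
  shows "contour_integral (circlepath 0 r) f = 0"
proof -
  have "uminus \<circ> circlepath 0 r = shiftpath (1/2) (circlepath 0 r)"
  proof
    fix x
    have "(uminus \<circ> circlepath 0 r) x = circlepath 0 (- r) x"
      by (simp add: circlepath)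
    also have "\<dots> = shiftpath (1/2) (circlepath 0 r) x"
      using circlepath_add_half[of 0 r x] by (auto simp: shiftpath_def circlepath_minus add.commute)
    finally show "(uminus \<circ> circlepath 0 r) x = shiftpath (1/2) (circlepath 0 r) x" .
  qed
  then have "contour_integral (circlepath 0 r) f = contour_integral (uminus \<circ> circlepath 0 r) f"
    by (simp add: contour_integral_shiftpath)
  also have "\<dots> = - contour_integral (circlepath 0 r) f"
    by (subst contour_integral_negatepath) (simp_all add: assms)
  finally show ?thesis by simp
qed

lemma argument_principle_circlepath:
  fixes f h :: "complex \<Rightarrow> complex"
  assumes f: "f holomorphic_on UNIV" and h: "h holomorphic_on UNIV" and "r > 0"
    and nz: "\<And>w. norm w = r \<Longrightarrow> f w \<noteq> 0"
  shows "finite {p. norm p < r \<and> f p = 0}"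
    and "contour_integral (circlepath 0 r) (\<lambda>w. deriv f w * h w / f w) =
           2 * pi * \<i> * (\<Sum>p | norm p < r \<and> f p = 0. h p * of_int (zorder f p))"
proof -
  \<comment> \<open>A constant function with a zero would also vanish at the point r of the
    circle.\<close>
  have nonconst: "\<not> f constant_on UNIV" if "f p = 0" for p
    using that nz[of "of_real r"] \<open>r > 0\<close> unfolding constant_on_def
    by (metis UNIV_I norm_of_real abs_of_pos)
  have fin: "finite {p \<in> cball 0 R. f p = 0}" for R
  proof (cases "\<exists>p. f p = 0")
    case True
    then show ?thesis
      using nonconst by (intro holomorphic_compact_finite_zeros[of f UNIV] f) auto
  next
    case False
    then show ?thesis by simp
  qed
  show "finite {p. norm p < r \<and> f p = 0}"
    by (rule finite_subset[OF _ fin[of r]]) auto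
  \<comment> \<open>A slightly larger ball, so that the circle lies inside an open set. Its zeros
    outside the circle drop out because the winding number is 0 there.\<close>
  define S :: "complex set" where "S = ball 0 (r + 1)"
  define pz where "pz = {w \<in> S. f w = 0 \<or> w \<in> {}}"
  have fin_pz: "finite pz"
    unfolding pz_def S_def by (rule finite_subset[OF _ fin[of "r + 1"]]) auto
  have S: "S = ball 0 (r + 1)" by (fact S_def)
  have "contour_integral (circlepath 0 r) (\<lambda>w. deriv f w * h w / f w) =
        2 * pi * \<i> * (\<Sum>p\<in>pz. winding_number (circlepath 0 r) p * h p * zorder f p)"
    unfolding pz_def
  proof (rule argument_principle)
    show "f holomorphic_on S - {}" "h holomorphic_on S"
      using f h by (auto intro: holomorphic_on_subset)
    show "path_image (circlepath 0 r) \<subseteq> S - {w \<in> S. f w = 0 \<or> w \<in> {}}"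
      using nz \<open>r > 0\<close> by (auto simp: S)
    show "\<forall>z. z \<notin> S \<longrightarrow> winding_number (circlepath 0 r) z = 0"
      using \<open>r > 0\<close> by (auto simp: S intro!: winding_number_zero_outside[of _ "cball 0 r"])
    show "finite {w \<in> S. f w = 0 \<or> w \<in> {}}" using fin_pz by (simp add: pz_def)
  qed (auto simp: S)
  also have "(\<Sum>p\<in>pz. winding_number (circlepath 0 r) p * h p * zorder f p) =
     (\<Sum>p | norm p < r \<and> f p = 0. h p * of_int (zorder f p))"
  proof (rule sum.mono_neutral_cong_right[OF fin_pz])
    show "{p. norm p < r \<and> f p = 0} \<subseteq> pz" by (auto simp: pz_def S)
    show "\<forall>p\<in>pz - {p. norm p < r \<and> f p = 0}. winding_number (circlepath 0 r) p * h p * zorder f p = 0"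
    proof
      fix p assume "p \<in> pz - {p. norm p < r \<and> f p = 0}"
      then have "norm p > r" using nz[of p] by (cases "norm p" r rule: linorder_cases) (auto simp: pz_def)
      then have "winding_number (circlepath 0 r) p = 0"
        using \<open>r > 0\<close> by (auto intro!: winding_number_zero_outside[of _ "cball 0 r"])
      then show "winding_number (circlepath 0 r) p * h p * zorder f p = 0" by simp
    qed
  qed (auto simp: winding_number_circlepath)
  finally show "contour_integral (circlepath 0 r) (\<lambda>w. deriv f w * h w / f w) =
           2 * pi * \<i> * (\<Sum>p | norm p < r \<and> f p = 0. h p * of_int (zorder f p))" .
qed

section \<open>Lower bounds for sinh away from its zeros\<close>

lemma norm_sinh_squared: "(norm (sinh z))\<^sup>2 = (sinh (Re z))\<^sup>2 + (sin (Im z))\<^sup>2" for z :: complex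
proof -
  have "sinh z = Complex (sinh (Re z) * cos (Im z)) (cosh (Re z) * sin (Im z))"
    by (simp add: complex_eq_iff sinh_field_def cosh_field_def Re_exp Im_exp algebra_simps add_divide_distrib diff_divide_distrib)
  then have "(norm (sinh z))\<^sup>2 = (sinh (Re z))\<^sup>2 * (cos (Im z))\<^sup>2 + (cosh (Re z))\<^sup>2 * (sin (Im z))\<^sup>2"
    by (simp add: cmod_power2 power_mult_distrib)
  also have "\<dots> = (sinh (Re z))\<^sup>2 + (sin (Im z))\<^sup>2"
    by (simp add: cos_squared_eq cosh_square_eq algebra_simps)
  finally show ?thesis .
qed

lemma norm_cosh_le: "norm (cosh z) \<le> exp \<bar>Re z\<bar>" for z :: complex
proof -
  have "norm (cosh z) \<le> (exp (Re z) + exp (- Re z)) / 2"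
    unfolding cosh_field_def using norm_triangle_ineq[of "exp z" "exp (- z)"] by (simp add: norm_divide)
  also have "\<dots> \<le> (exp \<bar>Re z\<bar> + exp \<bar>Re z\<bar>) / 2"
    by (intro divide_right_mono add_mono) simp_all
  also have "\<dots> = exp \<bar>Re z\<bar>" by simp
  finally show ?thesis .
qed

text \<open>The zeros of sinh have Re w = 0 and sin (Im w) = 0. By |sinh w|^2 = sinh^2 (Re w) +
  sin^2 (Im w), violating either condition by a fixed amount bounds |sinh w| from below.\<close>

definition off_zeros :: "complex \<Rightarrow> bool" where
  "off_zeros w \<longleftrightarrow> \<bar>Re w\<bar> \<ge> 1 \<or> \<bar>sin (Im w)\<bar> \<ge> 1/2"

text \<open>For |Re w| >= 1 the smaller exponential is at most half of the larger one, which gives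
  even 1/4. Otherwise exp |Re w| <= 3 and |sin (Im w)| >= 1/2, whence the 6.\<close>

lemma norm_sinh_ge:
  assumes "off_zeros w"
  shows "norm (sinh w) \<ge> exp \<bar>Re w\<bar> / 6"
proof (cases "\<bar>Re w\<bar> \<ge> 1")
  case True
  define x where "x = \<bar>Re w\<bar>"
  have "exp x \<ge> 2" using True exp_ge_add_one_self[of x] unfolding x_def by linarith
  have "exp (- x) \<le> 1" using True by (simp add: x_def)
  also have "1 \<le> exp x / 2" using \<open>exp x \<ge> 2\<close> by simp
  finally have "exp x / 6 \<le> sinh x" using \<open>exp x \<ge> 2\<close> by (simp add: sinh_field_def)
  also have "sinh x = \<bar>sinh (Re w)\<bar>" by (simp add: x_def abs_if)
  also have "\<dots> \<le> norm (sinh w)"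
    by (rule power2_le_imp_le) (simp_all add: norm_sinh_squared)
  finally show ?thesis by (simp add: x_def)
next
  case False
  then have "\<bar>sin (Im w)\<bar> \<ge> 1/2" using assms by (simp add: off_zeros_def)
  moreover have "exp \<bar>Re w\<bar> \<le> exp 1" using False by simp
  ultimately have "exp \<bar>Re w\<bar> / 6 \<le> \<bar>sin (Im w)\<bar>" using exp_le by linarith
  also have "\<dots> \<le> norm (sinh w)"
    by (rule power2_le_imp_le) (simp_all add: norm_sinh_squared)
  finally show ?thesis .
qed

lemma off_zeros_imp_sinh_nonzero: "off_zeros w \<Longrightarrow> sinh w \<noteq> 0"
  using norm_sinh_ge[of w] by (auto simp: not_less[symmetric])

text \<open>These radii keep the circles about 0 away from the zeros of \<open>sinh\<close>.\<close>

definition rad :: "nat \<Rightarrow> real" where "rad N = pi * (real N + 1/2)"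

lemma rad_pos [simp]: "rad N > 0"
  by (simp add: rad_def)

lemma rad_ge: "real N \<le> rad N"
proof -
  have "1 * real N \<le> pi * (real N + 1/2)"
    using pi_gt3 by (intro mult_mono) auto
  then show ?thesis by (simp add: rad_def)
qed

text \<open>At distance d from an odd multiple of pi / 2 the sine has modulus |cos d|, and 1/2 < pi
  / 3.\<close>

lemma abs_sin_near_rad:
  assumes "\<bar>\<bar>y\<bar> - rad N\<bar> \<le> 1/2"
  shows "\<bar>sin y\<bar> \<ge> 1/2"
proof -
  define d where "d = \<bar>y\<bar> - rad N"
  have "\<bar>sin y\<bar> = \<bar>sin \<bar>y\<bar>\<bar>" by (simp add: abs_if)
  also have "\<bar>y\<bar> = (d + pi / 2) + of_nat N * pi" by (simp add: d_def rad_def algebra_simps)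
  also have "\<bar>sin ((d + pi / 2) + of_nat N * pi)\<bar> = \<bar>cos d\<bar>"
    by (simp add: sin_add cos_add sin_npi cos_npi abs_mult)
  also have "cos d \<ge> cos (pi / 3)"
  proof -
    have "\<bar>d\<bar> \<le> pi / 3" using assms pi_gt3 by (simp add: d_def)
    then have "cos (pi / 3) \<le> cos \<bar>d\<bar>" by (intro cos_monotone_0_pi_le) auto
    then show ?thesis by simp
  qed
  then have "\<bar>cos d\<bar> \<ge> 1/2" by (simp add: cos_60)
  finally show ?thesis .
qed

lemma off_zeros_on_circle:
  assumes "norm w = rad N"
  shows "off_zeros w"
proof (cases "\<bar>Re w\<bar> \<ge> 1")
  case True
  then show ?thesis by (simp add: off_zeros_def)
next
  case False
  \<comment> \<open>For |Re w| < 1 the aim is |Im w| >= R - 1/2, which follows from (R - 1/2)^2 <=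
    R^2 - 1, true for R >= 5/4.\<close>
  have R: "rad N \<ge> 3/2" unfolding rad_def using pi_gt3 mult_mono[of 3 pi "1/2" "real N + 1/2"] by simp
  have "(rad N)\<^sup>2 = (Re w)\<^sup>2 + (Im w)\<^sup>2" using assms by (metis cmod_power2)
  moreover have "(Re w)\<^sup>2 \<le> 1" using False by (simp add: abs_square_le_1)
  moreover have "(rad N - 1/2)\<^sup>2 = (rad N)\<^sup>2 - rad N + 1/4" by (simp add: power2_eq_square algebra_simps)
  ultimately have "(rad N - 1/2)\<^sup>2 \<le> \<bar>Im w\<bar>\<^sup>2" using R by simp
  then have "rad N - 1/2 \<le> \<bar>Im w\<bar>" by (rule power2_le_imp_le) simp
  moreover have "\<bar>Im w\<bar> \<le> rad N" using abs_Im_le_cmod[of w] assms by simp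
  ultimately have "\<bar>\<bar>Im w\<bar> - rad N\<bar> \<le> 1/2" by simp
  then show ?thesis using abs_sin_near_rad by (simp add: off_zeros_def)
qed

section \<open>The zeros of sinh inside the circles\<close>

lemma sinh_zeros_in_disc:
  "{w. norm w < rad N \<and> sinh w = (0::complex)} = (\<lambda>n. \<i> * of_real (of_int n * pi)) ` {-int N..int N}"
proof -
  have eq: "sinh w = 0 \<longleftrightarrow> (\<exists>n::int. w = \<i> * of_real (of_int n * pi))" for w :: complex
  proof -
    have "sinh w = 0 \<longleftrightarrow> sin (\<i> * w) = 0" by (simp add: sinh_conv_sin)
    also have "\<dots> \<longleftrightarrow> (\<exists>n::int. \<i> * w = of_real (of_int n * pi))"
      by (auto simp: sin_eq_0)
    also have "\<dots> \<longleftrightarrow> (\<exists>n::int. w = \<i> * of_real (of_int (- n) * pi))"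
    proof -
      have "\<i> * w = of_real (of_int n * pi) \<longleftrightarrow> w = \<i> * of_real (of_int (- n) * pi)" for n
        by (auto simp: complex_eq_iff)
      then show ?thesis by simp
    qed
    also have "\<dots> \<longleftrightarrow> (\<exists>n::int. w = \<i> * of_real (of_int n * pi))"
      by (metis minus_minus)
    finally show ?thesis .
  qed
  have lt: "norm (\<i> * complex_of_real (of_int n * pi)) < rad N \<longleftrightarrow> n \<in> {-int N..int N}" for n :: int
  proof -
    have "norm (\<i> * complex_of_real (of_int n * pi)) = pi * \<bar>of_int n\<bar>"
      by (simp add: norm_mult abs_mult)
    moreover have "pi * \<bar>of_int n\<bar> < rad N \<longleftrightarrow> \<bar>of_int n\<bar> < real N + 1/2"
      by (simp add: rad_def mult_less_cancel_left_pos)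
    moreover have "\<bar>real_of_int n\<bar> < real N + 1/2 \<longleftrightarrow> \<bar>n\<bar> \<le> int N" by linarith
    ultimately show ?thesis by auto
  qed
  have "w \<in> {w. norm w < rad N \<and> sinh w = 0} \<longleftrightarrow> w \<in> (\<lambda>n. \<i> * of_real (of_int n * pi)) ` {-int N..int N}" for w :: complex
    unfolding mem_Collect_eq eq image_iff using lt by metis
  then show ?thesis by blast
qed

lemma deriv_sinh_complex: "deriv sinh w = cosh (w::complex)"
  by (rule DERIV_imp_deriv) (auto intro!: derivative_eq_intros)

lemma holomorphic_sinh: "sinh holomorphic_on (S :: complex set)"
  unfolding sinh_field_def[abs_def] by (intro holomorphic_intros) auto

lemma zorder_sinh:
  assumes "sinh w = (0::complex)"
  shows "zorder sinh w = 1"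
proof (rule zorder_zero_eqI[of _ UNIV])
  have "cosh w \<noteq> 0"
    using cosh_square_eq[of w] assms by auto
  then show "(deriv ^^ nat 1) sinh w \<noteq> 0"
    by (simp add: deriv_sinh_complex)
qed (use assms holomorphic_sinh in auto)

lemma contour_integral_coth:
  shows "contour_integral (circlepath 0 (rad N)) (\<lambda>w. cosh w / sinh w) = 2 * pi * \<i> * (2 * of_nat N + 1)"
proof -
  have "contour_integral (circlepath 0 (rad N)) (\<lambda>w. deriv sinh w * 1 / sinh w) =
     2 * pi * \<i> * (\<Sum>p | norm p < rad N \<and> sinh p = 0. 1 * of_int (zorder sinh p))"
    by (rule argument_principle_circlepath) (auto intro!: holomorphic_intros holomorphic_sinh dest: off_zeros_on_circle off_zeros_imp_sinh_nonzero)
  also have "(\<Sum>p | norm p < rad N \<and> sinh p = (0::complex). 1 * of_int (zorder sinh p)) =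
      (\<Sum>p | norm p < rad N \<and> sinh p = (0::complex). 1)"
    by (rule sum.cong) (auto simp: zorder_sinh)
  also have "\<dots> = 2 * of_nat N + 1"
    unfolding sinh_zeros_in_disc by (subst sum.reindex) (auto simp: inj_on_def)
  finally show ?thesis by (simp add: deriv_sinh_complex)
qed

section \<open>Comparison of zeros with those of the hyperbolic sine\<close>

text \<open>The differential equation is forgotten from here on. The expansion is multiplied by
  sinh, so that it makes sense for all large z, even at the zeros of sinh; the division takes place
  only on \<open>off_zeros\<close>.\<close>

locale sinh_asymptotics =
  fixes g :: "complex \<Rightarrow> complex" and c0 :: real and s K :: complex and C \<rho> :: real
  assumes holo_g: "g holomorphic_on UNIV"
    and asymp: "\<And>z. norm z \<ge> \<rho> \<Longrightarrow>
      norm (z * (z * g z - sinh (z - of_real c0)) + s * sinh (z - of_real c0) + K * cosh (z - of_real c0))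
      \<le> C / norm z * exp \<bar>Re z\<bar>"
begin

abbreviation "c \<equiv> complex_of_real c0"

definition "G = (\<lambda>w. g (w + c))"
text \<open>1 + q is the quotient whose logarithm is integrated, and - T / w is the leading part of
  q.\<close>

definition "q = (\<lambda>w. (w + c) * G w / sinh w - 1)"
definition "T = (\<lambda>w. s + K * (cosh w / sinh w))"
text \<open>Bounds |T| on \<open>off_zeros\<close>, where |cosh w / sinh w| <= 6.\<close>

definition "L0 = norm s + 6 * norm K"
text \<open>The bracket bounds |w|^2 |q + T / w|, with 24 = 6 2 2 from |z| >= |w| / 2 used twice.
  Adding L0 lets the same constant bound |w| |q|.\<close>

definition "M = L0 + (24 * \<bar>C\<bar> * exp \<bar>c0\<bar> + 2 * L0 * \<bar>c0\<bar>)"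
text \<open>With z = w + c0 the entries ensure, in this order, |w| <= |w|^2, |z| >= |w| / 2 and |z|
  >= \<rho>.\<close>

definition "\<rho>1 = max 1 (max (2 * \<bar>c0\<bar>) (\<bar>\<rho>\<bar> + \<bar>c0\<bar>))"

lemma holo_G: "G holomorphic_on UNIV"
proof -
  have "g \<circ> (\<lambda>w. w + c) holomorphic_on UNIV"
    by (rule holomorphic_on_compose) (auto intro!: holomorphic_intros holomorphic_on_subset[OF holo_g])
  then show ?thesis by (simp add: G_def o_def)
qed

lemma M_nonneg: "M \<ge> 0" and L0_nonneg: "L0 \<ge> 0"
  by (simp_all add: M_def L0_def)

lemma q_bounds:
  assumes w: "norm w \<ge> \<rho>1" "off_zeros w"
  shows "norm (q w + T w / w) \<le> M / (norm w)\<^sup>2" "norm (q w) \<le> M / norm w"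
proof -
  define z where "z = w + c"
  have w1: "norm w \<ge> 1" "norm w \<ge> 2 * \<bar>c0\<bar>" "norm w \<ge> \<bar>\<rho>\<bar> + \<bar>c0\<bar>"
    using w(1) by (auto simp: \<rho>1_def)
  have wz: "norm w - \<bar>c0\<bar> \<le> norm z"
    using norm_diff_ineq[of w c] by (simp add: z_def)
  have z: "norm z \<ge> norm w / 2" "norm z \<ge> \<rho>" "norm z > 0"
    using wz w1 by linarith+
  then have nz: "w \<noteq> 0" "z \<noteq> 0" using w1 by auto
  have S: "norm (sinh w) \<ge> exp \<bar>Re w\<bar> / 6" "sinh w \<noteq> 0"
    using norm_sinh_ge[OF w(2)] off_zeros_imp_sinh_nonzero[OF w(2)] by auto
  have T: "norm (T w) \<le> L0"
  proof -
    have "norm (cosh w) / norm (sinh w) \<le> exp \<bar>Re w\<bar> / (exp \<bar>Re w\<bar> / 6)"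
      using S norm_cosh_le[of w] by (intro frac_le) auto
    then have "norm (cosh w / sinh w) \<le> 6" by (simp add: norm_divide)
    then have "norm (K * (cosh w / sinh w)) \<le> norm K * 6"
      unfolding norm_mult by (intro mult_left_mono) auto
    then show ?thesis
      unfolding T_def L0_def by (intro order.trans[OF norm_triangle_ineq]) simp
  qed
  have zq: "norm (z * q w + T w) \<le> 6 * \<bar>C\<bar> * exp \<bar>c0\<bar> / norm z"
  proof -
    have "z * q w + T w = (z * (z * g z - sinh w) + s * sinh w + K * cosh w) / sinh w"
      using S(2) by (simp add: q_def T_def G_def z_def field_simps)
    also have "norm \<dots> \<le> (\<bar>C\<bar> / norm z * exp (\<bar>Re w\<bar> + \<bar>c0\<bar>)) / (exp \<bar>Re w\<bar> / 6)"
      unfolding norm_divide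
    proof (rule frac_le)
      have "norm (z * (z * g z - sinh w) + s * sinh w + K * cosh w) \<le> C / norm z * exp \<bar>Re z\<bar>"
        using asymp[OF z(2)] by (simp add: z_def)
      also have "\<dots> \<le> \<bar>C\<bar> / norm z * exp (\<bar>Re w\<bar> + \<bar>c0\<bar>)"
        by (intro mult_mono divide_right_mono) (auto simp: z_def)
      finally show "norm (z * (z * g z - sinh w) + s * sinh w + K * cosh w) \<le> \<bar>C\<bar> / norm z * exp (\<bar>Re w\<bar> + \<bar>c0\<bar>)" .
    qed (use S in auto)
    also have "\<dots> = 6 * \<bar>C\<bar> * exp \<bar>c0\<bar> / norm z"
      by (simp add: exp_add)
    finally show ?thesis .
  qed
  have "c = z - w" by (simp add: z_def)
  \<comment> \<open>The expansion has 1 / z where 1 / w is wanted; the difference is T c / (w z),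
    again of second order.\<close>
  then have "q w + T w / w = (z * q w + T w) / z + T w * c / (w * z)"
    using nz by (simp only:) (simp add: field_simps)
  also have "norm \<dots> \<le> 6 * \<bar>C\<bar> * exp \<bar>c0\<bar> / norm z / norm z + L0 * \<bar>c0\<bar> / (norm w * norm z)"
  proof (rule order.trans[OF norm_triangle_ineq], rule add_mono)
    show "norm ((z * q w + T w) / z) \<le> 6 * \<bar>C\<bar> * exp \<bar>c0\<bar> / norm z / norm z"
      unfolding norm_divide by (intro divide_right_mono zq) auto
    show "norm (T w * c / (w * z)) \<le> L0 * \<bar>c0\<bar> / (norm w * norm z)"
      unfolding norm_divide norm_mult norm_of_real by (intro divide_right_mono mult_right_mono T) auto
  qed
  also have "\<dots> \<le> 6 * \<bar>C\<bar> * exp \<bar>c0\<bar> / (norm w / 2) / (norm w / 2) + L0 * \<bar>c0\<bar> / (norm w * (norm w / 2))"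
    using z w1 nz L0_nonneg by (intro add_mono frac_le mult_left_mono) auto
  also have "\<dots> = (24 * \<bar>C\<bar> * exp \<bar>c0\<bar> + 2 * L0 * \<bar>c0\<bar>) / (norm w)\<^sup>2"
    using nz by (simp add: field_simps power2_eq_square)
  finally have *: "norm (q w + T w / w) \<le> (24 * \<bar>C\<bar> * exp \<bar>c0\<bar> + 2 * L0 * \<bar>c0\<bar>) / (norm w)\<^sup>2" .
  also have "\<dots> \<le> M / (norm w)\<^sup>2"
    using L0_nonneg by (intro divide_right_mono) (auto simp: M_def)
  finally show "norm (q w + T w / w) \<le> M / (norm w)\<^sup>2" .
  have "norm (q w) \<le> norm (q w + T w / w) + norm (T w / w)"
    using norm_triangle_ineq4[of "q w + T w / w" "T w / w"] by simp
  also have "\<dots> \<le> (24 * \<bar>C\<bar> * exp \<bar>c0\<bar> + 2 * L0 * \<bar>c0\<bar>) / norm w + L0 / norm w"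
  proof (rule add_mono)
    show "norm (q w + T w / w) \<le> (24 * \<bar>C\<bar> * exp \<bar>c0\<bar> + 2 * L0 * \<bar>c0\<bar>) / norm w"
    proof (rule order.trans[OF *], rule divide_left_mono)
      show "norm w \<le> (norm w)\<^sup>2" using w1(1) self_le_power[of "norm w" 2] by simp
    qed (use nz L0_nonneg in auto)
    show "norm (T w / w) \<le> L0 / norm w"
      unfolding norm_divide by (intro divide_right_mono T) auto
  qed
  also have "\<dots> = M / norm w" by (simp add: M_def add_divide_distrib)
  finally show "norm (q w) \<le> M / norm w" .
qed

text \<open>At a zero of G the value of q is -1, which is incompatible with |q| <= M / |w| <
  1.\<close>

lemma G_nonzero:
  assumes "norm w \<ge> \<rho>1" "off_zeros w" "norm w > M"
  shows "G w \<noteq> 0"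
proof
  assume "G w = 0"
  then have "norm (q w) = 1" by (simp add: q_def)
  moreover have "norm w > 0" using assms(3) M_nonneg by linarith
  then have "M / norm w < 1" using assms(3) by simp
  ultimately show False using q_bounds(2)[OF assms(1,2)] by simp
qed

definition "zeros N = {p. norm p < rad N \<and> G p = 0}"

text \<open>The condition with 2 M keeps |q| < 1/2 on the circle, so the principal logarithm of 1 +
  q is differentiable there; the one with |c0| puts the zero of w + c inside.\<close>

lemma zeros_on_disc:
  assumes N: "rad N \<ge> \<rho>1" "rad N > 2 * M" "rad N > \<bar>c0\<bar>"
  shows "finite (zeros N)"
    and "(\<Sum>p\<in>zeros N. of_int (zorder G p)) = (of_nat (2 * N) :: complex)"
    and "norm ((\<Sum>p\<in>zeros N. p * of_int (zorder G p)) - (s + c)) \<le> (2 * M\<^sup>2 + M) / rad N"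
proof -
  define R where "R = rad N"
  define \<gamma> where "\<gamma> = circlepath 0 R"
  have R: "R > 0" "R \<ge> \<rho>1" "R > 2 * M" "R > \<bar>c0\<bar>" using N by (auto simp: R_def)
  have S: "sinh w \<noteq> 0" "G w \<noteq> 0" "w + c \<noteq> 0" "w \<noteq> 0" "norm (q w) < 1/2"
    "norm (q w) \<le> M / R" "norm (q w + T w / w) \<le> M / R\<^sup>2"
    if "norm w = R" for w
  proof -
    have gd: "off_zeros w" using off_zeros_on_circle that by (simp add: R_def)
    show "sinh w \<noteq> 0" using off_zeros_imp_sinh_nonzero[OF gd] .
    show "G w \<noteq> 0" using G_nonzero[OF _ gd] that R M_nonneg by auto
    show "w \<noteq> 0" using that R by auto
    show "w + c \<noteq> 0" using that R by (auto simp: add_eq_0_iff2)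
    show "norm (q w) \<le> M / R" "norm (q w + T w / w) \<le> M / R\<^sup>2"
      using q_bounds[OF _ gd] that R by auto
    moreover have "M / R < 1/2" using R by (simp add: field_simps)
    ultimately show "norm (q w) < 1/2" by linarith
  qed
  have img: "path_image \<gamma> = sphere 0 R" using R by (simp add: \<gamma>_def)
  have integrable: "f contour_integrable_on \<gamma>" if "continuous_on (sphere 0 R) f" for f
    using that img unfolding \<gamma>_def by (intro contour_integrable_continuous_circlepath) simp
  have dG: "(G has_field_derivative deriv G w) (at w)" for w
    using holomorphic_derivI[OF holo_G] by simp
  have cG: "continuous_on X G" "continuous_on X (deriv G)" for X
    using holo_G holomorphic_deriv[OF holo_G]
    by (auto intro: holomorphic_on_imp_continuous_on holomorphic_on_subset)
  define lg where "lg = (\<lambda>w. Ln ((w + c) * G w / sinh w))"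
  define lg' where "lg' = (\<lambda>w. 1 / (w + c) + deriv G w / G w - cosh w / sinh w)"
  have lg_q: "lg w = Ln (1 + q w)" for w by (simp add: lg_def q_def)
  have der_lg: "(lg has_field_derivative lg' w) (at w)" if w: "norm w = R" for w
  proof -
    have "(w + c) * G w / sinh w \<notin> \<real>\<^sub>\<le>\<^sub>0"
    proof
      assume "(w + c) * G w / sinh w \<in> \<real>\<^sub>\<le>\<^sub>0"
      then have "1 + q w \<in> \<real>\<^sub>\<le>\<^sub>0" by (simp add: q_def)
      then have "Re (1 + q w) \<le> 0" by (simp add: complex_nonpos_Reals_iff)
      then show False using S(5)[OF w] abs_Re_le_cmod[of "q w"] by simp
    qed
    note der_Ln = has_field_derivative_Ln[OF this]
    have alg: "((y + x * y') * t - x * y * t') / (t * t) = x * y / t * (1 / x + y' / y - t' / t)"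
      if "x \<noteq> 0" "y \<noteq> 0" "t \<noteq> 0" for x y y' t t' :: complex
      using that by (simp add: field_simps)
    have "((\<lambda>w. (w + c) * G w / sinh w) has_field_derivative
        ((G w + (w + c) * deriv G w) * sinh w - (w + c) * G w * cosh w) / (sinh w * sinh w)) (at w)"
      by (rule derivative_eq_intros dG refl S(1)[OF w])+ (simp add: algebra_simps)
    then have "((\<lambda>w. (w + c) * G w / sinh w) has_field_derivative (w + c) * G w / sinh w * lg' w) (at w)"
      unfolding lg'_def alg[OF S(3)[OF w] S(2)[OF w] S(1)[OF w]] .
    from DERIV_chain2[OF der_Ln this] show ?thesis
      using S[OF w] by (simp add: lg_def)
  qed
  have cont_lg: "continuous_on (sphere 0 R) lg"
    by (intro continuous_at_imp_continuous_on ballI) (auto intro: DERIV_isCont[OF der_lg])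
  have cont_coth: "continuous_on (sphere 0 R) (\<lambda>w :: complex. cosh w / sinh w)"
    by (intro continuous_intros) (use S in auto)
  have cont_log: "continuous_on (sphere 0 R) (\<lambda>w. deriv G w / G w)"
    by (intro continuous_intros cG) (use S in auto)
  have cont_inv: "continuous_on (sphere 0 R) (\<lambda>w. 1 / (w + c))"
    by (intro continuous_intros) (use S in auto)
  have cont_lg': "continuous_on (sphere 0 R) lg'"
    unfolding lg'_def by (intro continuous_intros cont_coth cont_log cont_inv)
  \<comment> \<open>1 + q does not wind around 0, so \<open>lg\<close> is a primitive along the
    closed circle. Hence (w + c) G and sinh have equally many zeros inside, 2N + 1, one of which
    belongs to w + c.\<close>
  have int_lg': "contour_integral \<gamma> lg' = 0"
    by (rule contour_integral_unique,
        rule Cauchy_theorem_primitive[of "sphere 0 R" lg])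
       (auto simp: \<gamma>_def R less_imp_le intro: has_field_derivative_at_within der_lg)
  \<comment> \<open>Integration by parts, with w lg(w) as the primitive: the integral of w lg' is
    minus that of lg.\<close>
  have int_wlg: "contour_integral \<gamma> (\<lambda>w. lg w + w * lg' w) = 0"
  proof (rule contour_integral_unique, rule Cauchy_theorem_primitive[of "sphere 0 R" "\<lambda>w. w * lg w"])
    fix w :: complex assume "w \<in> sphere 0 R"
    then have "((\<lambda>w. w * lg w) has_field_derivative (lg w + w * lg' w)) (at w)"
      by (auto intro!: derivative_eq_intros der_lg)
    then show "((\<lambda>w. w * lg w) has_field_derivative (lg w + w * lg' w)) (at w within sphere 0 R)"
      by (rule has_field_derivative_at_within)
  qed (auto simp: \<gamma>_def R less_imp_le)
  have int_inv: "contour_integral \<gamma> (\<lambda>w. 1 / (w + c)) = 2 * pi * \<i>"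
  proof -
    have "((\<lambda>u. 1 / (u - (- c))) has_contour_integral (2 * of_real pi * \<i> * 1)) (circlepath 0 R)"
      using R by (intro Cauchy_integral_circlepath_simple) auto
    then show ?thesis by (simp add: \<gamma>_def contour_integral_unique)
  qed
  have int_1: "contour_integral \<gamma> (\<lambda>w. 1) = 0"
    by (rule contour_integral_unique, rule Cauchy_theorem_primitive[of UNIV "\<lambda>w. w"])
       (auto simp: \<gamma>_def)
  have nzG: "\<And>w. norm w = R \<Longrightarrow> G w \<noteq> 0" using S by blast
  note AP = argument_principle_circlepath[OF holo_G _ R(1) nzG]
  have zeros_R: "zeros N = {p. norm p < R \<and> G p = 0}" by (simp add: zeros_def R_def)
  show "finite (zeros N)"
    unfolding zeros_R by (rule AP(1)[of "\<lambda>_. 1"]) auto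
  have "2 * pi * \<i> * (\<Sum>p\<in>zeros N. 1 * of_int (zorder G p)) = contour_integral \<gamma> (\<lambda>w. deriv G w * 1 / G w)"
    unfolding zeros_R \<gamma>_def by (rule AP(2)[symmetric]) auto
  also have "\<dots> = contour_integral \<gamma> (\<lambda>w. lg' w - 1 / (w + c) + cosh w / sinh w)"
    by (simp add: lg'_def)
  also have "\<dots> = contour_integral \<gamma> lg' - contour_integral \<gamma> (\<lambda>w. 1 / (w + c)) + contour_integral \<gamma> (\<lambda>w. cosh w / sinh w)"
    by (rule contour_integral_unique)
       (intro has_contour_integral_add has_contour_integral_diff
          has_contour_integral_integral integrable cont_lg' cont_inv cont_coth)
  also have "\<dots> = 2 * pi * \<i> * of_nat (2 * N)"
    using contour_integral_coth[of N] unfolding int_lg' int_inv by (simp add: \<gamma>_def R_def algebra_simps)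
  finally show "(\<Sum>p\<in>zeros N. of_int (zorder G p)) = (of_nat (2 * N) :: complex)"
    by simp
  have cont_wlg: "continuous_on (sphere 0 R) (\<lambda>w. lg w + w * lg' w)"
    by (intro continuous_intros cont_lg cont_lg')
  have "2 * pi * \<i> * (\<Sum>p\<in>zeros N. p * of_int (zorder G p)) = contour_integral \<gamma> (\<lambda>w. deriv G w * w / G w)"
    unfolding zeros_R \<gamma>_def by (rule AP(2)[symmetric]) (auto intro!: holomorphic_intros)
  \<comment> \<open>The definition of \<open>lg'\<close> solved for G' / G, times w, where w lg' is
    prepared for the integration by parts and w / (w + c) is written as 1 - c / (w + c).\<close>
  also have "\<dots> = contour_integral \<gamma> (\<lambda>w. (lg w + w * lg' w) - lg w - (1 - c * (1 / (w + c))) + w * (cosh w / sinh w))"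
  proof (rule contour_integral_cong)
    fix w assume "w \<in> path_image \<gamma>"
    then have "norm w = R" using img by auto
    then show "deriv G w * w / G w = (lg w + w * lg' w) - lg w - (1 - c * (1 / (w + c))) + w * (cosh w / sinh w)"
    proof -
      have "x / (x + y) = 1 - y / (x + y)" if "x + y \<noteq> 0" for x y :: complex
        using that by (simp add: field_simps)
      from this[OF S(3)] \<open>norm w = R\<close> have "w * (1 / (w + c)) = 1 - c * (1 / (w + c))" by simp
      then show ?thesis
        unfolding lg'_def distrib_left right_diff_distrib by simp
    qed
  qed auto
  also have "\<dots> = contour_integral \<gamma> (\<lambda>w. lg w + w * lg' w) - contour_integral \<gamma> lg
     - (contour_integral \<gamma> (\<lambda>w. 1) - c * contour_integral \<gamma> (\<lambda>w. 1 / (w + c))) + contour_integral \<gamma> (\<lambda>w. w * (cosh w / sinh w))"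
    by (rule contour_integral_unique)
       (intro has_contour_integral_add has_contour_integral_diff has_contour_integral_lmul
          has_contour_integral_integral integrable continuous_intros cont_wlg cont_lg cont_inv cont_coth)
  \<comment> \<open>The integrand is even; equivalently, the zeros of sinh inside the circle sum to
    0.\<close>
  also have "contour_integral \<gamma> (\<lambda>w. w * (cosh w / sinh w)) = 0"
    unfolding \<gamma>_def by (rule contour_integral_even_circlepath) simp
  finally have sum_eq: "2 * pi * \<i> * (\<Sum>p\<in>zeros N. p * of_int (zorder G p)) = - contour_integral \<gamma> lg + 2 * pi * \<i> * c"
    unfolding int_wlg int_1 int_inv by (simp add: algebra_simps)
  have cont_T: "continuous_on (sphere 0 R) (\<lambda>w. T w / w)"
    unfolding T_def by (intro continuous_intros cont_coth) (use S in auto)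
  have "contour_integral \<gamma> (\<lambda>w. T w / w) = contour_integral \<gamma> (\<lambda>w. s * (1 / w) + K * (cosh w / sinh w / w))"
    by (simp add: T_def add_divide_distrib)
  also have "\<dots> = s * contour_integral \<gamma> (\<lambda>w. 1 / w) + K * contour_integral \<gamma> (\<lambda>w. cosh w / sinh w / w)"
  proof -
    have "continuous_on (sphere 0 R) (\<lambda>w. 1 / w :: complex)" "continuous_on (sphere 0 R) (\<lambda>w :: complex. cosh w / sinh w / w)"
      by (intro continuous_intros cont_coth; use S in auto)+
    then show ?thesis
      by (intro contour_integral_unique has_contour_integral_add has_contour_integral_lmul
            has_contour_integral_integral integrable)
  qed
  also have "contour_integral \<gamma> (\<lambda>w. cosh w / sinh w / w) = 0"
    unfolding \<gamma>_def by (rule contour_integral_even_circlepath) simp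
  also have "contour_integral \<gamma> (\<lambda>w. 1 / w) = 2 * pi * \<i>"
    using contour_integral_circlepath[OF R(1), of 0] by (simp add: \<gamma>_def)
  finally have int_T: "contour_integral \<gamma> (\<lambda>w. T w / w) = 2 * pi * \<i> * s" by simp
  have "norm (contour_integral \<gamma> (\<lambda>w. lg w + T w / w)) \<le> (2 * M\<^sup>2 + M) / R\<^sup>2 * (2 * pi * R)"
  proof (rule has_contour_integral_bound_circlepath[of _ _ 0])
    show "((\<lambda>w. lg w + T w / w) has_contour_integral contour_integral \<gamma> (\<lambda>w. lg w + T w / w)) (circlepath 0 R)"
      using integrable[OF continuous_on_add[OF cont_lg cont_T]]
      by (simp add: \<gamma>_def has_contour_integral_integral)
    fix w :: complex assume "norm (w - 0) = R"
    then have w: "norm w = R" by simp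
    \<comment> \<open>The quadratic error of Ln (1 + q): the denominator is at least 1/2, whence 2
      M^2. The other M comes from q + T / w.\<close>
    have "norm (lg w - q w) \<le> (norm (q w))\<^sup>2 / (1 - norm (q w))"
      unfolding lg_q using Ln_approx_linear[of "q w"] S(5)[OF w] by simp
    also have "\<dots> \<le> (M / R)\<^sup>2 / (1 / 2)"
      using S(5,6)[OF w] by (intro frac_le power_mono) auto
    finally have "norm (lg w - q w) \<le> 2 * M\<^sup>2 / R\<^sup>2" by (simp add: power_divide mult.commute)
    moreover have "norm (lg w + T w / w) \<le> norm (lg w - q w) + norm (q w + T w / w)"
      using norm_triangle_ineq[of "lg w - q w" "q w + T w / w"] by simp
    ultimately show "norm (lg w + T w / w) \<le> (2 * M\<^sup>2 + M) / R\<^sup>2"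
      using S(7)[OF w] by (simp add: add_divide_distrib)
  qed (use R M_nonneg in auto)
  also have "\<dots> = 2 * pi * ((2 * M\<^sup>2 + M) / R)"
    using R by (simp add: field_simps power2_eq_square)
  also have "contour_integral \<gamma> (\<lambda>w. lg w + T w / w) = - (2 * pi * \<i> * ((\<Sum>p\<in>zeros N. p * of_int (zorder G p)) - (s + c)))"
  proof -
    have "contour_integral \<gamma> (\<lambda>w. lg w + T w / w) = contour_integral \<gamma> lg + 2 * pi * \<i> * s"
      using int_T by (subst contour_integral_add) (auto intro!: integrable cont_lg cont_T)
    also have "contour_integral \<gamma> lg = 2 * pi * \<i> * c - 2 * pi * \<i> * (\<Sum>p\<in>zeros N. p * of_int (zorder G p))"
      unfolding sum_eq by simp
    finally show ?thesis by (simp add: algebra_simps)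
  qed
  also have "norm \<dots> = 2 * pi * norm ((\<Sum>p\<in>zeros N. p * of_int (zorder G p)) - (s + c))"
    by (simp add: norm_mult)
  finally show "norm ((\<Sum>p\<in>zeros N. p * of_int (zorder G p)) - (s + c)) \<le> (2 * M\<^sup>2 + M) / rad N"
    unfolding R_def by (rule mult_left_le_imp_le) simp
qed

end

section \<open>The eigenvalue sum\<close>

text \<open>By monotonicity and symmetry |y n| <= |y m| whenever |n| <= |m|, so the set is closed
  downwards in |n|. An element with |m| > N would bring along all 2N indices up to N and exceed the
  cardinality.\<close>

lemma index_set_eq:
  fixes y :: "int \<Rightarrow> real"
  assumes mono: "\<And>m n. m \<noteq> 0 \<Longrightarrow> n \<noteq> 0 \<Longrightarrow> m \<le> n \<Longrightarrow> y m \<le> y n"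
    and sym: "\<And>n. n \<noteq> 0 \<Longrightarrow> \<bar>y (- n)\<bar> = \<bar>y n\<bar>"
    and fin: "finite {n. n \<noteq> 0 \<and> \<bar>y n\<bar> < r}"
    and card: "card {n. n \<noteq> 0 \<and> \<bar>y n\<bar> < r} = 2 * N"
  shows "{n. n \<noteq> 0 \<and> \<bar>y n\<bar> < r} = {n. 1 \<le> \<bar>n\<bar> \<and> \<bar>n\<bar> \<le> int N}"
proof -
  define I where "I = {n. n \<noteq> 0 \<and> \<bar>y n\<bar> < r}"
  have J: "{n::int. 1 \<le> \<bar>n\<bar> \<and> \<bar>n\<bar> \<le> int N} = {- int N..int N} - {0}" by auto
  have fin_J: "finite {n::int. 1 \<le> \<bar>n\<bar> \<and> \<bar>n\<bar> \<le> int N}" and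
    card_J: "card {n::int. 1 \<le> \<bar>n\<bar> \<and> \<bar>n\<bar> \<le> int N} = 2 * N"
    unfolding J by (simp_all add: card_Diff_singleton)
  have down: "n \<in> I" if "m \<in> I" "n \<noteq> 0" "\<bar>n\<bar> \<le> \<bar>m\<bar>" for m n
  proof -
    have m: "m \<noteq> 0" "\<bar>y m\<bar> < r" using that by (auto simp: I_def)
    have "y (- \<bar>m\<bar>) \<le> y n" "y n \<le> y \<bar>m\<bar>"
      using m that by (auto intro!: mono)
    moreover have "\<bar>y \<bar>m\<bar>\<bar> = \<bar>y m\<bar>" "\<bar>y (- \<bar>m\<bar>)\<bar> = \<bar>y m\<bar>"
      using sym[OF m(1)] by (auto simp: abs_if)
    ultimately have "\<bar>y n\<bar> \<le> \<bar>y m\<bar>" by linarith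
    then show ?thesis using that m by (simp add: I_def)
  qed
  have "I \<subseteq> {n. 1 \<le> \<bar>n\<bar> \<and> \<bar>n\<bar> \<le> int N}"
  proof (rule ccontr)
    assume "\<not> ?thesis"
    then obtain m where m: "m \<in> I" "\<bar>m\<bar> > int N" by (force simp: I_def)
    then have "insert m {n. 1 \<le> \<bar>n\<bar> \<and> \<bar>n\<bar> \<le> int N} \<subseteq> I"
      by (auto intro!: down[OF m(1)])
    then have "card (insert m {n. 1 \<le> \<bar>n\<bar> \<and> \<bar>n\<bar> \<le> int N}) \<le> card I"
      using fin by (intro card_mono) (simp_all add: I_def)
    then show False using card fin_J card_J m(2) by (simp add: I_def)
  qed
  then have "I = {n. 1 \<le> \<bar>n\<bar> \<and> \<bar>n\<bar> \<le> int N}"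
    using fin_J card card_J by (intro card_subset_eq) (simp_all add: I_def)
  then show ?thesis by (simp add: I_def)
qed

lemma filterlim_rad: "filterlim rad at_top sequentially"
  by (rule filterlim_at_top_mono[OF filterlim_real_sequentially]) (simp add: rad_ge)

context sinh_asymptotics
begin

text \<open>Links the circles to the ordering by imaginary parts. A zero with |Im w| < R <= |w|
  cannot lie in \<open>off_zeros\<close>, so |Re w| < 1; then |Im w| is within 1/2 of R, where the
  sine is too large.\<close>

lemma norm_less_rad_iff_Im:
  assumes "rad N \<ge> \<rho>1" "rad N > M" "rad N \<ge> 2" "G w = 0"
  shows "norm w < rad N \<longleftrightarrow> \<bar>Im w\<bar> < rad N"
proof
  assume "norm w < rad N"
  then show "\<bar>Im w\<bar> < rad N" using abs_Im_le_cmod[of w] by linarith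
next
  assume Im: "\<bar>Im w\<bar> < rad N"
  show "norm w < rad N"
  proof (rule ccontr)
    assume ge: "\<not> norm w < rad N"
    then have "\<not> off_zeros w" using G_nonzero[of w] assms by auto
    then have Re: "\<bar>Re w\<bar> < 1" and sin: "\<bar>sin (Im w)\<bar> < 1/2" by (auto simp: off_zeros_def)
    have "(rad N)\<^sup>2 \<le> (norm w)\<^sup>2" using ge by (intro power_mono) (auto simp: less_imp_le)
    moreover have "(norm w)\<^sup>2 = (Re w)\<^sup>2 + (Im w)\<^sup>2" by (rule cmod_power2)
    moreover have "(Re w)\<^sup>2 \<le> 1" using Re by (simp add: abs_square_le_1)
    moreover have "(rad N - 1/2)\<^sup>2 = (rad N)\<^sup>2 - rad N + 1/4" by (simp add: power2_eq_square algebra_simps)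
    ultimately have "(rad N - 1/2)\<^sup>2 \<le> \<bar>Im w\<bar>\<^sup>2" using assms(3) by simp
    then have "rad N - 1/2 \<le> \<bar>Im w\<bar>" by (rule power2_le_imp_le) simp
    then have "\<bar>sin (Im w)\<bar> \<ge> 1/2" using Im by (intro abs_sin_near_rad[of _ N]) auto
    then show False using sin by simp
  qed
qed

text \<open>For large N the indices with 1 <= |n| <= N are exactly those of the zeros inside the
  N-th circle, so the symmetric partial sum equals the sum over the disc.\<close>

lemma sum_zeros_tendsto:
  fixes l :: "int \<Rightarrow> complex"
  assumes zero: "\<And>n. n \<noteq> 0 \<Longrightarrow> g (l n) = 0"
    and mult: "\<And>z. g z = 0 \<Longrightarrow> finite {n. n \<noteq> 0 \<and> l n = z} \<and> int (card {n. n \<noteq> 0 \<and> l n = z}) = zorder g z"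
    and mono: "\<And>m n. m \<noteq> 0 \<Longrightarrow> n \<noteq> 0 \<Longrightarrow> m \<le> n \<Longrightarrow> Im (l m) \<le> Im (l n)"
    and conj: "\<And>n. n \<noteq> 0 \<Longrightarrow> l n \<notin> \<real> \<Longrightarrow> l (- n) = cnj (l n)"
  shows "(\<lambda>N::nat. \<Sum>n\<in>{n::int. 1 \<le> \<bar>n\<bar> \<and> \<bar>n\<bar> \<le> int N}. (l n - c)) \<longlonglongrightarrow> s + c"
proof -
  \<comment> \<open>If l n is real, then l (- n) is real too, but possibly a different eigenvalue;
    hence only |Im| is symmetric.\<close>
  have Im_sym: "\<bar>Im (l (- n))\<bar> = \<bar>Im (l n)\<bar>" if n: "n \<noteq> 0" for n
  proof (cases "l n \<in> \<real>")
    case True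
    have "l (- n) \<in> \<real>"
    proof (rule ccontr)
      assume "l (- n) \<notin> \<real>"
      moreover from this have "l n = cnj (l (- n))" using conj[of "- n"] n by simp
      ultimately show False using True by (simp add: complex_is_Real_iff)
    qed
    then show ?thesis using True by (simp add: complex_is_Real_iff)
  next
    case False
    then show ?thesis using conj n by simp
  qed
  \<comment> \<open>Both orders are translated to the origin.\<close>
  have zorder_G: "zorder G p = zorder g (p + c)" for p
    unfolding G_def zorder_shift[of g "p + c"] zorder_shift[of "\<lambda>w. g (w + c)" p]
    by (simp add: add.assoc)
  have sum_eq: "(\<Sum>n\<in>{n::int. 1 \<le> \<bar>n\<bar> \<and> \<bar>n\<bar> \<le> int N}. (l n - c)) = (\<Sum>p\<in>zeros N. p * of_int (zorder G p))"
    if N: "rad N \<ge> \<rho>1" "rad N > 2 * M" "rad N > \<bar>c0\<bar>" "rad N \<ge> 2" for N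
  proof -
    define I where "I = {n. n \<noteq> 0 \<and> norm (l n - c) < rad N}"
    define F where "F = (\<lambda>p. {n. n \<noteq> 0 \<and> l n = p + c})"
    note Z = zeros_on_disc[OF N(1-3)]
    have F: "finite (F p)" "int (card (F p)) = zorder G p" if "p \<in> zeros N" for p
      using mult[of "p + c"] that unfolding zorder_G by (auto simp: F_def zeros_def G_def)
    have "I = (\<Union>p\<in>zeros N. F p)"
      by (auto simp: I_def F_def zeros_def G_def zero)
    then have fin_I: "finite I" using Z(1) F(1) by simp
    have img: "(\<lambda>n. l n - c) ` I \<subseteq> zeros N"
      by (auto simp: I_def zeros_def G_def zero)
    have fib: "{n \<in> I. l n - c = p} = F p" if "p \<in> zeros N" for p
      using that by (auto simp: I_def F_def zeros_def)
    \<comment> \<open>Indices are grouped by eigenvalue, with fibres of size \<open>zorder\<close>.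
      Applied to 1 this gives card I = 2N, applied to l n - c the weighted sum of zeros.\<close>
    have group: "sum h I = (\<Sum>p\<in>zeros N. \<Sum>n\<in>F p. h n)" for h :: "int \<Rightarrow> complex"
      unfolding sum.group[OF fin_I Z(1) img, symmetric] by (rule sum.cong) (simp_all add: fib)
    have of_card: "of_nat (card (F p)) = (of_int (zorder G p) :: complex)" if "p \<in> zeros N" for p
      using arg_cong[OF F(2)[OF that], of of_int] by simp
    have "of_nat (card I) = (\<Sum>n\<in>I. 1 :: complex)" by simp
    also have "\<dots> = (\<Sum>p\<in>zeros N. of_int (zorder G p))"
      unfolding group by (rule sum.cong) (simp_all add: of_card)
    also have "\<dots> = of_nat (2 * N)" by (rule Z(2))
    finally have card_I: "card I = 2 * N" by (simp only: of_nat_eq_iff)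
    have I_Im: "I = {n. n \<noteq> 0 \<and> \<bar>Im (l n)\<bar> < rad N}"
    proof -
      have "norm (l n - c) < rad N \<longleftrightarrow> \<bar>Im (l n)\<bar> < rad N" if "n \<noteq> 0" for n
        using norm_less_rad_iff_Im[of N "l n - c"] N M_nonneg zero[OF that] by (simp add: G_def)
      then show ?thesis by (auto simp: I_def)
    qed
    have "I = {n. 1 \<le> \<bar>n\<bar> \<and> \<bar>n\<bar> \<le> int N}"
      unfolding I_Im
      by (rule index_set_eq) (use mono Im_sym fin_I card_I in \<open>simp_all add: I_Im\<close>)
    then have "(\<Sum>n\<in>{n::int. 1 \<le> \<bar>n\<bar> \<and> \<bar>n\<bar> \<le> int N}. (l n - c)) = (\<Sum>p\<in>zeros N. \<Sum>n\<in>F p. l n - c)"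
      using group by simp
    also have "\<dots> = (\<Sum>p\<in>zeros N. p * of_int (zorder G p))"
    proof (rule sum.cong[OF refl])
      fix p assume p: "p \<in> zeros N"
      have "(\<Sum>n\<in>F p. l n - c) = (\<Sum>n\<in>F p. p)" by (rule sum.cong) (auto simp: F_def)
      then show "(\<Sum>n\<in>F p. l n - c) = p * of_int (zorder G p)"
        using of_card[OF p] by simp
    qed
    finally show ?thesis .
  qed
  have ev: "\<forall>\<^sub>F N in sequentially. rad N \<ge> \<rho>1 \<and> rad N > 2 * M \<and> rad N > \<bar>c0\<bar> \<and> rad N \<ge> 2"
    using filterlim_rad filterlim_rad[unfolded filterlim_at_top_dense]
    by (intro eventually_conj) (simp_all add: filterlim_at_top)
  have lim: "(\<lambda>N. (2 * M\<^sup>2 + M) / rad N) \<longlonglongrightarrow> 0"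
    by (rule real_tendsto_divide_at_top[OF tendsto_const filterlim_rad])
  show ?thesis
  proof (rule Lim_transform_eventually[OF _ eventually_mono[OF ev]])
    show "(\<lambda>N. \<Sum>p\<in>zeros N. p * of_int (zorder G p)) \<longlonglongrightarrow> s + c"
    proof (subst LIM_zero_iff[symmetric], rule Lim_null_comparison[OF eventually_mono[OF ev] lim])
      fix N assume "rad N \<ge> \<rho>1 \<and> rad N > 2 * M \<and> rad N > \<bar>c0\<bar> \<and> rad N \<ge> 2"
      then show "norm ((\<Sum>p\<in>zeros N. p * of_int (zorder G p)) - (s + c)) \<le> (2 * M\<^sup>2 + M) / rad N"
        using zeros_on_disc(3) by blast
    qed
  qed (simp add: sum_eq)
qed

end

section \<open>Application to the damped equation\<close>

lemma continuous_on_unit_interval_bounded: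
  fixes f :: "real \<Rightarrow> real"
  assumes "continuous_on {0..1} f"
  obtains B where "\<And>x. x \<in> {0..1} \<Longrightarrow> \<bar>f x\<bar> \<le> B"
proof -
  have "bounded (f ` {0..1})"
    using assms by (intro compact_imp_bounded compact_continuous_image) auto
  then show ?thesis using that unfolding bounded_iff by (metis imageI real_norm_def)
qed

theorem theorem4:
  fixes a b :: "real \<Rightarrow> real" and l :: "int \<Rightarrow> complex" and c0 :: real
  assumes "Ck_unit_interval 3 a" and "Ck_unit_interval 2 b"
    and "eigenvalue_enumeration a b l"
    and "c0 = - integral {0..1} a"
  shows "(\<lambda>N::nat. \<Sum>n\<in>{n::int. 1 \<le> \<bar>n\<bar> \<and> \<bar>n\<bar> \<le> int N}. (l n - of_real c0))
           \<longlonglongrightarrow> of_real ((a 0 + a 1) / 2 - integral {0..1} a)"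
proof -
  obtain Da where Da: "Da 0 = a"
      "\<And>i x. i < 3 \<Longrightarrow> x \<in> {0..1} \<Longrightarrow> (Da i has_real_derivative Da (Suc i) x) (at x within {0..1})"
    using assms(1) unfolding Ck_unit_interval_def by blast
  obtain Db where Db: "Db 0 = b"
      "\<And>i x. i < 2 \<Longrightarrow> x \<in> {0..1} \<Longrightarrow> (Db i has_real_derivative Db (Suc i) x) (at x within {0..1})"
    using assms(2) unfolding Ck_unit_interval_def by blast
  define a' a'' b' where "a' = Da 1" and "a'' = Da 2" and "b' = Db 1"
  have der: "(a has_real_derivative a' x) (at x within {0..1})"
      "(a' has_real_derivative a'' x) (at x within {0..1})"
      "(b has_real_derivative b' x) (at x within {0..1})" if "x \<in> {0..1}" for x
    using Da(2)[of 0 x] Da(2)[of 1 x] Db(2)[of 0 x] that Da(1) Db(1)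
    by (simp_all add: a'_def a''_def b'_def numeral_2_eq_2)
  have cont_a: "continuous_on {0..1} a" and cont_a': "continuous_on {0..1} a'"
    and cont_b: "continuous_on {0..1} b"
    by (rule DERIV_continuous_on, rule der, assumption)+
  have cont_a'': "continuous_on {0..1} a''"
    unfolding a''_def by (rule DERIV_continuous_on, rule Da) auto
  have cont_b': "continuous_on {0..1} b'"
    unfolding b'_def by (rule DERIV_continuous_on, rule Db) auto
  \<comment> \<open>A bound for the sum of the five moduli bounds each of them, which yields the
    common B of the locale.\<close>
  have cont: "continuous_on {0..1} (\<lambda>x. \<bar>a x\<bar> + \<bar>a' x - (a x)\<^sup>2 - b x\<bar> + \<bar>a' x + (a x)\<^sup>2 + b x\<bar>
       + \<bar>a'' x - 2 * a x * a' x - b' x\<bar> + \<bar>a'' x + 2 * a x * a' x + b' x\<bar>)"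
    by (intro continuous_intros cont_a cont_a' cont_a'' cont_b cont_b')
  obtain B where B: "\<And>x. x \<in> {0..1} \<Longrightarrow> \<bar>\<bar>a x\<bar> + \<bar>a' x - (a x)\<^sup>2 - b x\<bar> + \<bar>a' x + (a x)\<^sup>2 + b x\<bar>
       + \<bar>a'' x - 2 * a x * a' x - b' x\<bar> + \<bar>a'' x + 2 * a x * a' x + b' x\<bar>\<bar> \<le> B"
    by (rule continuous_on_unit_interval_bounded[OF cont], rule that)
  interpret D: damped_coefficients a a' a'' b b' "\<lambda>x. integral {0..x} a" B
  proof
    fix x :: real assume x: "x \<in> {0..1}"
    have gen: "p \<le> B \<and> q \<le> B \<and> r \<le> B \<and> t \<le> B \<and> v \<le> B"
      if "p + q + r + t + v \<le> B" "p \<ge> 0" "q \<ge> 0" "r \<ge> 0" "t \<ge> 0" "v \<ge> 0" for p q r t v :: real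
      using that by linarith
    show "\<bar>a x\<bar> \<le> B" "\<bar>a' x - (a x)\<^sup>2 - b x\<bar> \<le> B" "\<bar>a' x + (a x)\<^sup>2 + b x\<bar> \<le> B"
      "\<bar>a'' x - 2 * a x * a' x - b' x\<bar> \<le> B" "\<bar>a'' x + 2 * a x * a' x + b' x\<bar> \<le> B"
      using gen[OF abs_le_D1[OF B[OF x]] abs_ge_zero abs_ge_zero abs_ge_zero abs_ge_zero abs_ge_zero] by blast+
  qed (use der cont_a'' cont_b' in auto)
  obtain K C \<rho> where K: "\<And>z. norm z \<ge> \<rho> \<Longrightarrow>
     norm (z * (z * gamma0 a b z - sinh (z + of_real (integral {0..1} a)))
       + of_real ((a 0 + a 1) / 2) * sinh (z + of_real (integral {0..1} a))
       + of_real K * cosh (z + of_real (integral {0..1} a))) \<le> C / norm z * exp \<bar>Re z\<bar>"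
    using D.gamma0_asymptotics by blast
  interpret S: sinh_asymptotics "gamma0 a b" c0 "of_real ((a 0 + a 1) / 2)" "of_real K" C \<rho>
  proof
    show "gamma0 a b holomorphic_on UNIV" by (rule holomorphic_gamma0[OF cont_a cont_b])
    \<comment> \<open>The phase integral A(1) is - c0, so sinh and cosh are taken at w = z -
      c0.\<close>
    have "z - of_real c0 = z + of_real (integral {0..1} a)" for z :: complex
      by (simp add: assms(4))
    then show "norm (z * (z * gamma0 a b z - sinh (z - of_real c0))
       + of_real ((a 0 + a 1) / 2) * sinh (z - of_real c0) + of_real K * cosh (z - of_real c0))
       \<le> C / norm z * exp \<bar>Re z\<bar>" if "norm z \<ge> \<rho>" for z
      using K[OF that] by (simp only:)
  qed
  note ev = assms(3)[unfolded eigenvalue_enumeration_def dirichlet_eigenvalue_iff_gamma0[OF cont_a cont_b]]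
  have "(\<lambda>N::nat. \<Sum>n\<in>{n::int. 1 \<le> \<bar>n\<bar> \<and> \<bar>n\<bar> \<le> int N}. (l n - of_real c0))
      \<longlonglongrightarrow> of_real ((a 0 + a 1) / 2) + of_real c0"
  proof (rule S.sum_zeros_tendsto)
    show "gamma0 a b (l n) = 0" if "n \<noteq> 0" for n
      using ev that by (elim conjE) simp
    show "finite {n. n \<noteq> 0 \<and> l n = z} \<and> int (card {n. n \<noteq> 0 \<and> l n = z}) = zorder (gamma0 a b) z"
      if "gamma0 a b z = 0" for z
      using ev that by (elim conjE) simp
    show "Im (l m) \<le> Im (l n)" if "m \<noteq> 0" "n \<noteq> 0" "m \<le> n" for m n
      using ev that by (elim conjE) simp
    show "l (- n) = cnj (l n)" if "n \<noteq> 0" "l n \<notin> \<real>" for n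
      using ev that by (elim conjE) simp
  qed
  also have "complex_of_real ((a 0 + a 1) / 2) + of_real c0 = of_real ((a 0 + a 1) / 2 - integral {0..1} a)"
    by (simp add: assms(4))
  finally show ?thesis .
qed

end
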